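(* For each positive integer $n$, the coefficients of the Chebyshev-Blaschke product $f_{n,\tau}$, i.e. the functions $\pm S_{n,j}$ ($1\le j\le\lfloor n/2\rfloor$) occurring in $$f_{n,\tau}(z)=z^{(1-(-1)^n)/2}\,\frac{z^{2\lfloor n/2\rfloor}+\sum_{j=1}^{\lfloor n/2\rfloor}(-1)^jS_{n,j}(\tau)z^{2\lfloor n/2\rfloor-2j}}{1+\sum_{j=1}^{\lfloor n/2\rfloor}(-1)^jS_{n,j}(\tau)z^{2j}},$$ are, via their $q$-expansions, in $\operatorname{Frac}(\mathbb{Z}[[q^{1/4}]])$, the field of fractions of the ring of power series in $q^{1/4}$ over $\mathbb{Z}$. Consequently $f_{n,\tau}$ is defined over $\mathbb{Z}[[q^{1/4}]]$, i.e. it can be written as a quotient of two polynomials in $z$ with coefficients in $\mathbb{Z}[[q^{1/4}]]$.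
   Context: $\mathbb{H}$ is the open upper half plane. For $\tau\in\mathbb{H}$ put $q=e^{2\pi i\tau}$, $q^s=e^{2\pi i s\tau}$, and $$\vartheta_2(v,\tau)=\sum_{m=-\infty}^\infty q^{(m+1/2)^2}e^{(2m+1)iv},\qquad \vartheta_3(v,\tau)=\sum_{m=-\infty}^\infty q^{m^2}e^{2miv},$$ $$\omega_1(\tau)=\vartheta_3^2(0,\tau),\qquad \sqrt{k(\tau)}=\frac{\vartheta_2(0,\tau)}{\vartheta_3(0,\tau)}.$$ The Chebyshev-Blaschke product $f_{n,\tau}$ ($\tau\in\mathbb{R}_{>0}i$) is the finite Blaschke product on the unit disk defined by $f_{n,\tau}(z)=\sqrt{k(n\tau)}\,cd(n\omega_1(n\tau)u,n\tau)$ where $z=\sqrt{k(\tau)}\,cd(\omega_1(\tau)u,\tau)$, with $cd=cn/dn$ the quotient of Jacobi elliptic functions; equivalently $f_{n,\tau}\big(\vartheta_2(u,\tau)/\vartheta_3(u,\tau)\big)=\vartheta_2(nu,n\tau)/\vartheta_3(nu,n\tau)$. Explicitly, $$f_{n,\tau}(z)=z^{(1-(-1)^n)/2}\prod_{i=1}^{\lfloor n/2\rfloor}\frac{z^2-b_i}{1-b_iz^2},\qquad b_i(\tau)=\frac{\vartheta_2^2((2i-1)\pi/2n,\tau)}{\vartheta_3^2((2i-1)\pi/2n,\tau)}.$$ For $1\le j\le\lfloor n/2\rfloor$, $S_{n,j}=\sum_{1\le i_1<\cdots<i_j\le\lfloor n/2\rfloor}b_{i_1}\cdots b_{i_j}$;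 these are meromorphic functions of $\tau\in\mathbb{H}$ and are identified with their expansions in powers of $q^{1/4}$. *)

theory Defs
  imports "HOL-Complex_Analysis.Complex_Analysis"
begin

definition upper_half_plane :: "complex set" where
  "upper_half_plane = {\<tau>. Im \<tau> > 0}"

definition pos_imag_axis :: "complex set" where
  "pos_imag_axis = {\<tau>. Re \<tau> = 0 \<and> Im \<tau> > 0}"

text \<open>
  The power \<open>q^s\<close> of \<open>q = e^(2\<pi>i\<tau>)\<close>, as a function of \<open>\<tau>\<close>. Note that \<open>q\<close> is the square of the
  classical nome of an elliptic function with period ratio \<open>\<tau>\<close>: the theta functions below are the
  classical ones for the period ratio \<open>2\<tau>\<close>.
\<close>
definition qpow :: "complex \<Rightarrow> real \<Rightarrow> complex" where
  "qpow \<tau> s = exp (2 * of_real pi * \<i> * of_real s * \<tau>)"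

definition theta2 :: "complex \<Rightarrow> complex \<Rightarrow> complex" where
  "theta2 v \<tau> =
     (\<Sum>\<^sub>\<infinity>m\<in>(UNIV::int set). qpow \<tau> ((of_int m + 1/2)\<^sup>2) * exp (of_int (2*m + 1) * \<i> * v))"

definition theta3 :: "complex \<Rightarrow> complex \<Rightarrow> complex" where
  "theta3 v \<tau> =
     (\<Sum>\<^sub>\<infinity>m\<in>(UNIV::int set). qpow \<tau> ((of_int m)\<^sup>2) * exp (of_int (2*m) * \<i> * v))"

definition omega1 :: "complex \<Rightarrow> complex" where
  "omega1 \<tau> = (theta3 0 \<tau>)\<^sup>2"

definition sqrt_k :: "complex \<Rightarrow> complex" where
  "sqrt_k \<tau> = theta2 0 \<tau> / theta3 0 \<tau>"

text \<open>
  The Jacobi function \<open>cd = cn / dn\<close>. Jacobi's expressions of \<open>cn\<close> and \<open>dn\<close> by theta functions,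
  with \<open>v = w / \<theta>\<^sub>3(0)\<^sup>2\<close>, are
  \<open>cn w = \<theta>\<^sub>4(0) \<theta>\<^sub>2(v) / (\<theta>\<^sub>2(0) \<theta>\<^sub>4(v))\<close> and \<open>dn w = \<theta>\<^sub>4(0) \<theta>\<^sub>3(v) / (\<theta>\<^sub>3(0) \<theta>\<^sub>4(v))\<close>.
  The factors \<open>\<theta>\<^sub>4\<close> are cancelled here, so that the value is also right at the common poles of
  \<open>cn\<close> and \<open>dn\<close>, where \<open>cd\<close> is regular. The poles of \<open>cd\<close> are the points with \<open>\<theta>\<^sub>3(v) = 0\<close>.
\<close>
definition jacobi_cd :: "complex \<Rightarrow> complex \<Rightarrow> complex" where
  "jacobi_cd w \<tau> =
     (theta3 0 \<tau> / theta2 0 \<tau>) * (theta2 (w / omega1 \<tau>) \<tau> / theta3 (w / omega1 \<tau>) \<tau>)"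

text \<open>
  The Chebyshev-Blaschke product, for \<open>\<tau>\<close> on the positive imaginary axis and \<open>z\<close> in the unit
  disk: the value at \<open>z = \<surd>k(\<tau>) cd(\<omega>\<^sub>1(\<tau>) u, \<tau>)\<close> is \<open>\<surd>k(n\<tau>) cd(n \<omega>\<^sub>1(n\<tau>) u, n\<tau>)\<close>. The condition
  \<open>theta3 u \<tau> \<noteq> 0\<close> says that \<open>\<omega>\<^sub>1(\<tau>) u\<close> is not a pole of \<open>cd\<close>; without it the convention
  \<open>x / 0 = 0\<close> would make the poles spurious parameters of the point \<open>z = 0\<close>.
\<close>
definition chebyshev_blaschke :: "nat \<Rightarrow> complex \<Rightarrow> complex \<Rightarrow> complex" where
  "chebyshev_blaschke n \<tau> z =
     (THE w. \<exists>u. theta3 u \<tau> \<noteq> 0 \<and>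
        z = sqrt_k \<tau> * jacobi_cd (omega1 \<tau> * u) \<tau> \<and>
        w = sqrt_k (of_nat n * \<tau>) *
              jacobi_cd (of_nat n * omega1 (of_nat n * \<tau>) * u) (of_nat n * \<tau>))"

definition b_coeff :: "nat \<Rightarrow> nat \<Rightarrow> complex \<Rightarrow> complex" where
  "b_coeff n i \<tau> =
     (theta2 (of_real ((2 * real i - 1) * pi / (2 * real n))) \<tau>)\<^sup>2 /
     (theta3 (of_real ((2 * real i - 1) * pi / (2 * real n))) \<tau>)\<^sup>2"

text \<open>
  The elementary symmetric functions of the \<open>b_i\<close>; the index sets \<open>i\<^sub>1 < \<dots> < i\<^sub>j\<close> are the
  \<open>j\<close>-element subsets.
\<close>
definition S_coeff :: "nat \<Rightarrow> nat \<Rightarrow> complex \<Rightarrow> complex" where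
  "S_coeff n j \<tau> = (\<Sum>I | I \<subseteq> {1..n div 2} \<and> card I = j. \<Prod>i\<in>I. b_coeff n i \<tau>)"

text \<open>
  The meromorphic function \<open>g\<close> on the upper half plane has the expansion \<open>F\<close> in powers of
  \<open>q^(1/4)\<close>, i.e. \<open>g\<close> is a function \<open>G\<close> of \<open>q^(1/4)\<close> with Laurent series \<open>F\<close> at \<open>0\<close>.
\<close>
definition has_q4_expansion :: "(complex \<Rightarrow> complex) \<Rightarrow> complex fls \<Rightarrow> bool" where
  "has_q4_expansion g F \<longleftrightarrow>
     g meromorphic_on upper_half_plane \<and>
     (\<exists>G. G has_laurent_expansion F \<and> (\<forall>\<tau>\<in>upper_half_plane. g \<tau> = G (qpow \<tau> (1/4))))"

definition fps_int_to_complex :: "int fps \<Rightarrow> complex fps" where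
  "fps_int_to_complex P = Abs_fps (\<lambda>k. of_int (fps_nth P k))"

text \<open>
  The field of fractions of \<open>\<int>[[X]]\<close>, realised inside the field of formal Laurent series over
  the complex numbers.
\<close>
definition Frac_int_fps :: "complex fls set" where
  "Frac_int_fps =
     {fps_to_fls (fps_int_to_complex P) / fps_to_fls (fps_int_to_complex Q) | P Q. Q \<noteq> 0}"

text \<open>
  Evaluation of the coefficients of a polynomial over \<open>\<int>[[X]]\<close> at \<open>X = q^(1/4)\<close>. It is only
  meaningful if the coefficients converge there, which is the second definition.
\<close>
definition eval_coeffs_q4 :: "int fps poly \<Rightarrow> complex \<Rightarrow> complex poly" where
  "eval_coeffs_q4 A \<tau> = map_poly (\<lambda>P. eval_fps (fps_int_to_complex P) (qpow \<tau> (1/4))) A"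

definition coeffs_converge_q4 :: "int fps poly \<Rightarrow> complex \<Rightarrow> bool" where
  "coeffs_converge_q4 A \<tau> \<longleftrightarrow>
     (\<forall>k. ereal (norm (qpow \<tau> (1/4))) < fps_conv_radius (fps_int_to_complex (coeff A k)))"

end

theory Submission
  imports Defs
begin

text \<open>
  Put \<open>z(u) = \<theta>\<^sub>2(u, \<tau>) / \<theta>\<^sub>3(u, \<tau>)\<close>. The Chebyshev-Blaschke product sends \<open>z(u)\<close> to
  \<open>\<theta>\<^sub>2(nu, n\<tau>) / \<theta>\<^sub>3(nu, n\<tau>)\<close>. That this is a well-defined rational function of \<open>z\<close> comes from two
  facts. By the Jacobi triple product (\<open>jacobi_triple_product\<close>), \<open>\<theta>\<^sub>3(nu, n\<tau>)\<close> and \<open>\<theta>\<^sub>2(nu, n\<tau>)\<close> are,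
  with the same constant factor, the products of \<open>\<theta>\<^sub>3(u + v, \<tau>)\<close> and \<open>\<theta>\<^sub>2(u + v, \<tau>)\<close> over \<open>n\<close> real
  shifts \<open>v\<close> that are symmetric about \<open>0\<close> (\<open>theta_multiplication\<close>). By the addition formulas
  (\<open>theta_addition\<close>), the quotient for a pair of shifts \<open>v, -v\<close> is a Blaschke factor
  \<open>(z\<^sup>2 - b) / (1 - b z\<^sup>2)\<close>. Every \<open>z\<close> has a parameter \<open>u\<close>, since an elliptic function that omits a value
  is constant (\<open>theta_quotient_surj\<close>). On the imaginary axis \<open>|b_i| < 1\<close>, because \<open>\<theta>\<^sub>3\<^sup>2 - \<theta>\<^sub>2\<^sup>2\<close>
  factors into values at real points \<open>x\<close> of \<open>\<theta>\<^sub>3(x, \<tau>/2)\<close>, which is real and without zeros there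
  (\<open>norm_b_coeff_less_1\<close>).

  For the arithmetic part, the expansion of \<open>\<theta>\<^sub>2(x, \<tau>)\<^sup>2 / \<theta>\<^sub>3(x, \<tau>)\<^sup>2\<close> in powers of \<open>q^(1/4)\<close> has
  coefficients in \<open>\<int>[e^(2ix), e^(-2ix)]\<close>, because the expansion of \<open>\<theta>\<^sub>3\<close> has constant term \<open>1\<close>. The same
  holds for its powers. Summing an exponential \<open>e^(2imx)\<close> over the \<open>n\<close> nodes \<open>x = (2i-1)\<pi>/2n\<close> gives an
  integer (\<open>laurent_ring_trace\<close>), so the power sums of all \<open>n\<close> numbers \<open>b_i\<close>, which are twice those of
  the first \<open>n div 2\<close> of them, are power series with integer coefficients. They converge for \<open>|q| < 1\<close>
  since \<open>\<theta>\<^sub>3\<close> has no real zeros. Newton's identities (\<open>newton_identity\<close>) express the elementary symmetric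
  functions \<open>S_j\<close> through the power sums at the cost of integer denominators, and these are invisible in
  the field of fractions of \<open>\<int>[[q^(1/4)]]\<close>. A common denominator also clears the coefficients of the
  rational function simultaneously (\<open>chebyshev_blaschke_integral_quotient\<close>).
\<close>

section \<open>The q-binomial theorem\<close>

text \<open>
  The \<open>q\<close>-Pochhammer symbol \<open>(r; r)\<^sub>N\<close>.
\<close>
definition qpoch :: "complex \<Rightarrow> nat \<Rightarrow> complex" where
  "qpoch r N = (\<Prod>i<N. 1 - r ^ Suc i)"

definition qbinom :: "complex \<Rightarrow> nat \<Rightarrow> nat \<Rightarrow> complex" where
  "qbinom r M k = (if k \<le> M then qpoch r M / (qpoch r k * qpoch r (M - k)) else 0)"

lemma qpoch_0 [simp]: "qpoch r 0 = 1"
  by (simp add: qpoch_def)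

lemma qpoch_Suc: "qpoch r (Suc N) = qpoch r N * (1 - r ^ Suc N)"
  by (simp add: qpoch_def)

lemma power_neq_1:
  fixes r :: complex
  assumes "norm r < 1"
  shows "r ^ Suc i \<noteq> 1"
proof
  assume "r ^ Suc i = 1"
  hence "norm r ^ Suc i = 1" by (metis norm_one norm_power)
  moreover have "norm r ^ Suc i \<le> norm r"
    using assms power_decreasing[of 1 "Suc i" "norm r"] by simp
  ultimately show False using assms by simp
qed

lemma qpoch_nonzero:
  assumes "norm r < 1"
  shows "qpoch r N \<noteq> 0"
  using power_neq_1[OF assms] by (auto simp: qpoch_def)

lemma qbinom_0 [simp]: "norm r < 1 \<Longrightarrow> qbinom r M 0 = 1"
  by (simp add: qbinom_def qpoch_nonzero)

text \<open>
  The \<open>q\<close>-Pascal rule; it rests on \<open>1 - r^(k+d+2) = (1 - r^(d+1)) + r^(d+1) (1 - r^(k+1))\<close>.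
\<close>
lemma qbinom_Suc_Suc:
  assumes "norm r < 1" "k \<le> M"
  shows "qbinom r (Suc M) (Suc k) = qbinom r M (Suc k) + r ^ (M - k) * qbinom r M k"
proof (cases "k = M")
  case True
  thus ?thesis using assms qpoch_nonzero[OF assms(1)] by (simp add: qbinom_def)
next
  case False
  then obtain d where d: "M = Suc (k + d)" using assms(2)
    by (metis le_neq_implies_less less_iff_Suc_add)
  note nz = qpoch_nonzero[OF assms(1)]
  have nz1: "1 - r ^ Suc i \<noteq> 0" for i using power_neq_1[OF assms(1), of i] by auto
  define a where "a = qpoch r M"
  define u where "u = 1 - r ^ Suc k"
  define v where "v = 1 - r ^ Suc d"
  have uv: "1 - r ^ Suc M = v + r ^ Suc d * u"
    by (simp add: u_def v_def d algebra_simps power_add)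
  have "qbinom r (Suc M) (Suc k) = a * (v + r ^ Suc d * u) / ((qpoch r k * u) * (qpoch r d * v))"
    using d uv by (simp add: qbinom_def qpoch_Suc a_def u_def v_def mult_ac)
  also have "\<dots> = a / ((qpoch r k * u) * qpoch r d) + r ^ Suc d * (a / (qpoch r k * (qpoch r d * v)))"
    using nz[of k] nz[of d] nz1[of k] nz1[of d] unfolding u_def[symmetric] v_def[symmetric]
    by (simp add: divide_simps) (simp add: algebra_simps)
  also have "\<dots> = qbinom r M (Suc k) + r ^ (M - k) * qbinom r M k"
    by (simp add: qbinom_def d qpoch_Suc a_def u_def v_def)
  finally show ?thesis .
qed

theorem qbinomial_theorem:
  assumes "norm r < 1"
  shows "(\<Prod>i<M. 1 + r ^ i * y) = (\<Sum>k\<le>M. qbinom r M k * r ^ (k choose 2) * y ^ k)"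
proof (induction M)
  case 0
  then show ?case by (simp add: assms numeral_2_eq_2)
next
  case (Suc M)
  define c where "c = (\<lambda>M k. qbinom r M k * r ^ (k choose 2) * y ^ k)"
  have step: "c (Suc M) (Suc k) = c M (Suc k) + r ^ M * y * c M k" if "k \<le> M" for k
  proof -
    have "r ^ (Suc k choose 2) = r ^ k * r ^ (k choose 2)"
      by (simp add: numeral_2_eq_2 power_add)
    moreover have "r ^ M = r ^ (M - k) * r ^ k"
      using that by (simp flip: power_add)
    ultimately show ?thesis
      by (simp add: c_def qbinom_Suc_Suc[OF assms that] algebra_simps)
  qed
  have "(\<Sum>k\<le>Suc M. c (Suc M) k) = c (Suc M) 0 + (\<Sum>k\<le>M. c (Suc M) (Suc k))"
    by (rule sum.atMost_Suc_shift)
  also have "(\<Sum>k\<le>M. c (Suc M) (Suc k)) = (\<Sum>k\<le>M. c M (Suc k)) + r ^ M * y * (\<Sum>k\<le>M. c M k)"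
    by (simp add: step sum.distrib sum_distrib_left)
  also have "c (Suc M) 0 + \<dots> = (c M 0 + (\<Sum>k\<le>M. c M (Suc k))) + r ^ M * y * (\<Sum>k\<le>M. c M k)"
    by (simp add: c_def assms)
  also have "c M 0 + (\<Sum>k\<le>M. c M (Suc k)) = (\<Sum>k\<le>M. c M k)"
    using sum.atMost_Suc_shift[of "c M" M] by (simp add: c_def qbinom_def)
  finally show ?case
    using Suc.IH by (simp add: c_def algebra_simps)
qed

section \<open>The Jacobi triple product\<close>

text \<open>
  The partial products of the triple product. The normalising factor \<open>\<Prod>(1 - s^(2m))\<close> is left out:
  it does not depend on \<open>x\<close>, and only the dependence on \<open>x\<close> matters below.
\<close>
definition jprod :: "complex \<Rightarrow> complex \<Rightarrow> nat \<Rightarrow> complex" where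
  "jprod s x N = (\<Prod>m<N. (1 + s ^ (2 * m + 1) * x) * (1 + s ^ (2 * m + 1) / x))"

definition jterm :: "complex \<Rightarrow> complex \<Rightarrow> int \<Rightarrow> complex" where
  "jterm s x m = s ^ nat (m\<^sup>2) * x powi m"

text \<open>
  Both theta functions come from this one series at \<open>s = q\<close>: its value at \<open>x = e^(2iv)\<close> is \<open>\<theta>\<^sub>3(v)\<close>,
  and its value at \<open>x = q e^(2iv)\<close>, multiplied by \<open>q^(1/4) e^(iv)\<close>, is \<open>\<theta>\<^sub>2(v)\<close>.
\<close>
definition jtheta :: "complex \<Rightarrow> complex \<Rightarrow> complex" where
  "jtheta s x = (\<Sum>\<^sub>\<infinity>m. jterm s x m)"

lemma prod_odd_powers: "(\<Prod>m<N. s ^ (2 * m + 1)) = (s :: 'a :: comm_monoid_mult) ^ (N ^ 2)"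
proof (induction N)
  case (Suc N)
  have "(Suc N)\<^sup>2 = N\<^sup>2 + (2 * N + 1)" by (simp add: power2_eq_square)
  thus ?case using Suc by (simp only: prod.lessThan_Suc power_add)
qed simp

lemma two_times_choose_two: "2 * (k choose 2) = k * (k - 1)"
  by (cases k) (simp_all add: choose_two)

text \<open>
  This is the \<open>q\<close>-binomial theorem with \<open>2N\<close> factors at \<open>r = s\<^sup>2\<close> and \<open>y = s^(1-2N) x\<close>. With this
  choice the exponents of \<open>s\<close> in the factors \<open>1 + r^i y\<close> run symmetrically through the odd numbers
  between \<open>-2N\<close> and \<open>2N\<close>; pulling \<open>x\<close> and the negative powers of \<open>s\<close> out of the first \<open>N\<close> factors
  turns them into the factors \<open>1 + s^(2m+1) / x\<close>.
\<close>
lemma finite_triple_product: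
  assumes s: "s \<noteq> 0" "norm s < 1" and x: "x \<noteq> 0"
  shows "jprod s x N = (\<Sum>k\<le>2*N. qbinom (s\<^sup>2) (2*N) k * jterm s x (int k - int N))"
proof -
  define y where "y = s * x / s ^ (2 * N)"
  have r: "norm (s\<^sup>2) < 1" using s by (simp add: norm_power power_less_one_iff)
  have "{..<2*N} = {..<N} \<union> {N..<N+N}" "{..<N} \<inter> {N..<N+N} = {}" by auto
  hence "(\<Prod>i<2*N. 1 + (s\<^sup>2) ^ i * y) = (\<Prod>i<N. 1 + (s\<^sup>2) ^ i * y) * (\<Prod>i=N..<N+N. 1 + (s\<^sup>2) ^ i * y)"
    by (simp add: prod.union_disjoint)
  also have "(\<Prod>i=N..<N+N. 1 + (s\<^sup>2) ^ i * y) = (\<Prod>m<N. 1 + s ^ (2 * m + 1) * x)"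
  proof (rule prod.reindex_bij_witness[of _ "\<lambda>m. m + N" "\<lambda>i. i - N"], goal_cases)
    case (5 i)
    hence "N \<le> i" by simp
    hence "2 * i = 2 * (i - N) + 2 * N" by linarith
    hence "(s\<^sup>2) ^ i = s ^ (2 * (i - N)) * s ^ (2 * N)" by (metis power_add power_mult)
    thus ?case using s by (simp add: y_def mult_ac)
  qed auto
  also have "(\<Prod>i<N. 1 + (s\<^sup>2) ^ i * y) = (\<Prod>m<N. x / s ^ (2 * m + 1) * (1 + s ^ (2 * m + 1) / x))"
  proof (rule prod.reindex_bij_witness[of _ "\<lambda>m. N - Suc m" "\<lambda>i. N - Suc i"], goal_cases)
    case (5 i)
    define m where "m = N - Suc i"
    have "2 * N = 2 * i + 1 + (2 * m + 1)" using 5 by (simp add: m_def)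
    hence "s ^ (2 * N) = s ^ (2 * i) * s * s ^ (2 * m + 1)" by (metis power_add power_one_right)
    thus ?case using s x unfolding m_def[symmetric]
      by (simp add: y_def field_simps flip: power_mult)
  qed auto
  also have "\<dots> = x ^ N / s ^ (N\<^sup>2) * (\<Prod>m<N. 1 + s ^ (2 * m + 1) / x)"
    by (simp only: prod.distrib prod_dividef prod_odd_powers) simp
  finally have "jprod s x N = s ^ (N\<^sup>2) / x ^ N * (\<Prod>i<2*N. 1 + (s\<^sup>2) ^ i * y)"
    using s x by (simp add: jprod_def prod.distrib)
  also have "\<dots> = (\<Sum>k\<le>2*N. s ^ (N\<^sup>2) / x ^ N * (qbinom (s\<^sup>2) (2*N) k * (s\<^sup>2) ^ (k choose 2) * y ^ k))"
    by (simp add: qbinomial_theorem[OF r] sum_distrib_left)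
  also have "\<dots> = (\<Sum>k\<le>2*N. qbinom (s\<^sup>2) (2*N) k * jterm s x (int k - int N))"
  proof (rule sum.cong)
    fix k
    have e: "nat ((int k - int N)\<^sup>2) + 2 * N * k = N\<^sup>2 + 2 * (k choose 2) + k"
    proof -
      have "int (nat ((int k - int N)\<^sup>2)) = (int k - int N)\<^sup>2" by simp
      hence "int (nat ((int k - int N)\<^sup>2) + 2 * N * k) = int (N\<^sup>2 + k * (k - 1) + k)"
        unfolding of_nat_add by (cases k) (simp_all add: power2_eq_square algebra_simps)
      thus ?thesis by (simp only: two_times_choose_two of_nat_eq_iff)
    qed
    have "s ^ nat ((int k - int N)\<^sup>2) * s ^ (2 * N * k) = s ^ (N\<^sup>2) * s ^ (2 * (k choose 2)) * s ^ k"
      by (simp only: e flip: power_add)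
    hence "s ^ nat ((int k - int N)\<^sup>2) = s ^ (N\<^sup>2) * s ^ (2 * (k choose 2)) * s ^ k / s ^ (2 * N * k)"
      using s by (simp add: field_simps)
    moreover have "x powi (int k - int N) = x ^ k / x ^ N"
      using x by (simp add: power_int_diff)
    moreover have "y ^ k = s ^ k * x ^ k / s ^ (2 * N * k)"
      by (simp add: y_def power_divide power_mult_distrib flip: power_mult)
    ultimately show "s ^ (N\<^sup>2) / x ^ N * (qbinom (s\<^sup>2) (2*N) k * (s\<^sup>2) ^ (k choose 2) * y ^ k) =
           qbinom (s\<^sup>2) (2*N) k * jterm s x (int k - int N)"
      by (simp only: jterm_def power_mult [symmetric]) (simp add: mult_ac)
  qed auto
  finally show ?thesis .
qed

lemma qpoch_tendsto:
  assumes "norm r < 1"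
  obtains L where "L \<noteq> 0" "qpoch r \<longlonglongrightarrow> L"
proof
  have "summable (\<lambda>i. norm r ^ Suc i)"
    using assms by (subst summable_Suc_iff) (auto intro: summable_geometric)
  hence "abs_convergent_prod (\<lambda>i. 1 - r ^ Suc i)"
    by (subst abs_convergent_prod_conv_summable) (simp add: norm_power norm_mult)
  hence conv: "convergent_prod (\<lambda>i. 1 - r ^ Suc i)"
    by (rule abs_convergent_prod_imp_convergent_prod)
  from convergent_prod_LIMSEQ[OF conv] show "qpoch r \<longlonglongrightarrow> prodinf (\<lambda>i. 1 - r ^ Suc i)"
    unfolding qpoch_def LIMSEQ_lessThan_iff_atMost .
  have "1 - r ^ Suc i \<noteq> 0" for i
    using power_neq_1[OF assms, of i] by simp
  thus "prodinf (\<lambda>i. 1 - r ^ Suc i) \<noteq> 0"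
    by (intro prodinf_nonzero conv)
qed

text \<open>
  The symbols \<open>(r; r)\<^sub>N\<close> converge to a nonzero limit, so they and their inverses are bounded. The
  resulting uniform bound is the domination that Tannery's theorem needs in the triple product.
\<close>
lemma qbinom_bounded:
  assumes "norm r < 1"
  obtains C where "\<And>M k. norm (qbinom r M k) \<le> C"
proof -
  obtain L where L: "L \<noteq> 0" "qpoch r \<longlonglongrightarrow> L"
    using qpoch_tendsto[OF assms] .
  obtain A where A: "\<And>n. norm (qpoch r n) \<le> A" "A > 0"
    using BseqE[OF convergent_imp_Bseq[OF convergentI[OF L(2)]]] by metis
  obtain B where B: "\<And>n. norm (inverse (qpoch r n)) \<le> B" "B > 0"
    using BseqE[OF convergent_imp_Bseq[OF convergentI[OF tendsto_inverse[OF L(2) L(1)]]]] by metis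
  have "norm (qbinom r M k) \<le> A * (B * B)" for M k
  proof (cases "k \<le> M")
    case True
    hence "norm (qbinom r M k) =
      norm (qpoch r M) * (norm (inverse (qpoch r k)) * norm (inverse (qpoch r (M - k))))"
      by (simp add: qbinom_def norm_mult norm_divide norm_inverse divide_simps)
    also have "\<dots> \<le> A * (B * B)"
      using A B by (intro mult_mono) (auto intro: less_imp_le)
    finally show ?thesis .
  qed (use A B in \<open>simp add: qbinom_def\<close>)
  thus thesis using that by blast
qed

lemma qbinom_central_tendsto:
  assumes "norm r < 1" "L \<noteq> 0" "qpoch r \<longlonglongrightarrow> L"
  shows "(\<lambda>N. qbinom r (2 * N) (N + k)) \<longlonglongrightarrow> 1 / L"
proof -
  have "filterlim (\<lambda>N::nat. 2 * N) at_top at_top"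
    by (rule filterlim_subseq) (simp add: strict_mono_def)
  moreover have "filterlim (\<lambda>N::nat. N + k) at_top at_top"
    by (rule filterlim_subseq) (simp add: strict_mono_def)
  moreover have "filterlim (\<lambda>N::nat. N - k) at_top at_top"
    by (rule filterlim_minus_const_nat_at_top)
  ultimately have "(\<lambda>N. qpoch r (2 * N) / (qpoch r (N + k) * qpoch r (N - k))) \<longlonglongrightarrow> L / (L * L)"
    by (intro tendsto_intros filterlim_compose[OF assms(3)]) (use assms in auto)
  moreover have "eventually (\<lambda>N. qpoch r (2 * N) / (qpoch r (N + k) * qpoch r (N - k))
                  = qbinom r (2 * N) (N + k)) sequentially"
    using eventually_ge_at_top[of k]
  proof eventually_elim
    case (elim N)
    hence "2 * N - (N + k) = N - k" by linarith
    thus ?case using elim by (simp add: qbinom_def)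
  qed
  ultimately show ?thesis using assms(2)
    by (simp add: tendsto_cong field_simps)
qed

lemma summable_square_powers:
  fixes r R :: real
  assumes "0 \<le> r" "r < 1" "0 \<le> R"
  shows "summable (\<lambda>n. r ^ n\<^sup>2 * R ^ n)"
proof (rule summable_comparison_test_ev)
  have "(\<lambda>n. r ^ n * R) \<longlonglongrightarrow> 0 * R"
    using assms by (intro tendsto_intros LIMSEQ_power_zero) auto
  hence "eventually (\<lambda>n. r ^ n * R < 1 / 2) sequentially"
    by (rule order_tendstoD) auto
  thus "eventually (\<lambda>n. norm (r ^ n\<^sup>2 * R ^ n) \<le> (1 / 2) ^ n) sequentially"
  proof eventually_elim
    case (elim n)
    have "r ^ n\<^sup>2 * R ^ n = (r ^ n * R) ^ n"
      by (simp add: power2_eq_square power_mult power_mult_distrib)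
    also have "\<dots> \<le> (1 / 2) ^ n"
      using elim assms by (intro power_mono) auto
    finally show ?case using assms by simp
  qed
qed (simp add: summable_geometric)

lemma norm_jterm_nat: "norm (jterm s x (int n)) = norm s ^ n\<^sup>2 * norm x ^ n"
  by (simp add: jterm_def norm_mult norm_power power_int_def flip: of_nat_power)

lemma norm_jterm_neg: "norm (jterm s x (- int n)) = norm s ^ n\<^sup>2 * norm (inverse x) ^ n"
  by (simp add: jterm_def norm_mult norm_power norm_inverse norm_power_int power_int_minus
        power_inverse flip: of_nat_power)

lemma summable_norm_jterm:
  assumes "norm s < 1"
  shows "summable (\<lambda>n. norm (jterm s x (int n)))" "summable (\<lambda>n. norm (jterm s x (- int n)))"
  using assms by (auto simp: norm_jterm_nat norm_jterm_neg intro!: summable_square_powers)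

lemma int_UNIV_split: "(UNIV :: int set) = range int \<union> range (\<lambda>n. - int (Suc n))"
proof -
  have "x \<in> range int \<or> x \<in> range (\<lambda>n. - int (Suc n))" for x :: int
    by (cases x rule: int_cases) auto
  thus ?thesis by blast
qed

lemma jterm_abs_summable:
  assumes "norm s < 1"
  shows "(\<lambda>m. norm (jterm s x m)) summable_on UNIV"
  unfolding int_UNIV_split
proof (rule summable_on_union)
  show "(\<lambda>m. norm (jterm s x m)) summable_on range int"
    using summable_norm_jterm(1)[OF assms, of x]
    by (subst summable_on_reindex) (auto simp: o_def intro!: summable_nonneg_imp_summable_on)
  have "summable (\<lambda>n. norm (jterm s x (- int (Suc n))))"
    using summable_norm_jterm(2)[OF assms, of x] by (subst summable_Suc_iff)
  thus "(\<lambda>m. norm (jterm s x m)) summable_on range (\<lambda>n. - int (Suc n))"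
    by (subst summable_on_reindex)
       (auto simp: o_def inj_on_def intro!: summable_nonneg_imp_summable_on)
qed

lemma jterm_summable: "norm s < 1 \<Longrightarrow> jterm s x summable_on UNIV"
  using jterm_abs_summable abs_summable_summable by blast

lemma jtheta_conv_suminf:
  assumes "norm s < 1"
  shows "jtheta s x = (\<Sum>n. jterm s x (int n)) + (\<Sum>n. jterm s x (- int (Suc n)))"
proof -
  have summ: "jterm s x summable_on A" for A
    using jterm_summable[OF assms] by (rule summable_on_subset_banach) auto
  have "jtheta s x = infsum (jterm s x) (range int) + infsum (jterm s x) (range (\<lambda>n. - int (Suc n)))"
    unfolding jtheta_def int_UNIV_split by (rule infsum_Un_disjoint) (auto simp: summ)
  also have "infsum (jterm s x) (range int) = (\<Sum>n. jterm s x (int n))"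
  proof -
    have "infsum (jterm s x) (range int) = infsum (jterm s x \<circ> int) UNIV"
      by (rule infsum_reindex) auto
    also have "\<dots> = (\<Sum>n. (jterm s x \<circ> int) n)"
      using summ[of "range int"]
      by (intro sums_unique has_sum_imp_sums has_sum_infsum) (simp add: summable_on_reindex o_def)
    finally show ?thesis by (simp add: o_def)
  qed
  also have "infsum (jterm s x) (range (\<lambda>n. - int (Suc n))) = (\<Sum>n. jterm s x (- int (Suc n)))"
  proof -
    have inj: "inj (\<lambda>n. - int (Suc n))" by (auto simp: inj_on_def)
    have "infsum (jterm s x) (range (\<lambda>n. - int (Suc n))) = infsum (jterm s x \<circ> (\<lambda>n. - int (Suc n))) UNIV"
      by (rule infsum_reindex[OF inj])
    also have "\<dots> = (\<Sum>n. (jterm s x \<circ> (\<lambda>n. - int (Suc n))) n)"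
      using summ[of "range (\<lambda>n. - int (Suc n))"] unfolding summable_on_reindex[OF inj]
      by (intro sums_unique has_sum_imp_sums has_sum_infsum)
    finally show ?thesis by (simp add: o_def)
  qed
  finally show ?thesis .
qed

lemma jprod_conv_central_sums:
  assumes s: "s \<noteq> 0" "norm s < 1" and x: "x \<noteq> 0"
  shows "jprod s x N = (\<Sum>n. qbinom (s\<^sup>2) (2*N) (N + n) * jterm s x (int n)) +
                       (\<Sum>n. qbinom (s\<^sup>2) (2*N) (N + Suc n) * jterm s x (- int (Suc n)))"
proof -
  define c where "c = (\<lambda>k. qbinom (s\<^sup>2) (2*N) k * jterm s x (int k - int N))"
  \<comment> \<open>The coefficients are symmetric about the centre \<open>N\<close>; both halves are read off from it outwards.\<close>
  have sym: "qbinom (s\<^sup>2) (2*N) (N + Suc n) = qbinom (s\<^sup>2) (2*N) (N - Suc n)" if "n < N" for n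
  proof -
    have "2 * N - (N + Suc n) = N - Suc n" "2 * N - (N - Suc n) = N + Suc n" using that by linarith+
    thus ?thesis using that by (simp add: qbinom_def mult.commute)
  qed
  have "{..2*N} = {N..2*N} \<union> {..<N}" "{N..2*N} \<inter> {..<N} = {}" by auto
  hence "jprod s x N = (\<Sum>k=N..2*N. c k) + (\<Sum>k<N. c k)"
    by (simp add: finite_triple_product[OF s x] c_def sum.union_disjoint)
  also have "(\<Sum>k=N..2*N. c k) = (\<Sum>n\<le>N. qbinom (s\<^sup>2) (2*N) (N + n) * jterm s x (int n))"
    by (rule sum.reindex_bij_witness[of _ "\<lambda>n. n + N" "\<lambda>k. k - N"]) (auto simp: c_def of_nat_diff)
  also have "\<dots> = (\<Sum>n. qbinom (s\<^sup>2) (2*N) (N + n) * jterm s x (int n))"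
    by (rule suminf_finite [symmetric]) (auto simp: qbinom_def)
  also have "(\<Sum>k<N. c k) = (\<Sum>n<N. qbinom (s\<^sup>2) (2*N) (N + Suc n) * jterm s x (- int (Suc n)))"
  proof (rule sum.reindex_bij_witness[of _ "\<lambda>n. N - Suc n" "\<lambda>k. N - Suc k"], goal_cases)
    case (5 k)
    hence "N - Suc (N - Suc k) = k" "- int (Suc (N - Suc k)) = int k - int N" by auto
    thus ?case using 5 sym[of "N - Suc k"] by (simp only: c_def)
  qed auto
  also have "\<dots> = (\<Sum>n. qbinom (s\<^sup>2) (2*N) (N + Suc n) * jterm s x (- int (Suc n)))"
    by (rule suminf_finite [symmetric]) (auto simp: qbinom_def)
  finally show ?thesis .
qed

text \<open>
  In the finite triple product the coefficient of each term tends to \<open>1 / L\<close> with \<open>L\<close> the limit of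
  \<open>(s\<^sup>2; s\<^sup>2)\<^sub>N\<close>, and Tannery's theorem exchanges limit and sum. The constant stays anonymous: it is
  enough that it is nonzero and independent of \<open>x\<close>.
\<close>
theorem jacobi_triple_product:
  assumes s: "s \<noteq> 0" "norm s < 1"
  obtains C where "C \<noteq> 0" "\<And>x. x \<noteq> 0 \<Longrightarrow> jprod s x \<longlonglongrightarrow> C * jtheta s x"
proof -
  have r: "norm (s\<^sup>2) < 1" using s by (simp add: norm_power power_less_one_iff)
  obtain L where L: "L \<noteq> 0" "qpoch (s\<^sup>2) \<longlonglongrightarrow> L"
    using qpoch_tendsto[OF r] .
  obtain K where K: "\<And>M k. norm (qbinom (s\<^sup>2) M k) \<le> K"
    using qbinom_bounded[OF r] by blast
  have "jprod s x \<longlonglongrightarrow> 1 / L * jtheta s x" if x: "x \<noteq> 0" for x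
  proof -
    have tannery: "(\<lambda>N. \<Sum>n. qbinom (s\<^sup>2) (2*N) (N + g n) * f n) \<longlonglongrightarrow> (\<Sum>n. 1 / L * f n)"
      if "summable (\<lambda>n. norm (f n))" for f :: "nat \<Rightarrow> complex" and g :: "nat \<Rightarrow> nat"
    proof -
      have 1: "(\<lambda>N. qbinom (s\<^sup>2) (2*N) (N + g n) * f n) \<longlonglongrightarrow> 1 / L * f n" for n
        by (intro tendsto_intros qbinom_central_tendsto r L)
      have 2: "eventually (\<lambda>(n, N). norm (qbinom (s\<^sup>2) (2*N) (N + g n) * f n) \<le> K * norm (f n))
                (at_top \<times>\<^sub>F sequentially)"
        by (intro always_eventually) (auto simp: norm_mult intro!: mult_right_mono K)
      show ?thesis
        using tannerys_theorem[OF 1 2] that by (simp add: summable_mult)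
    qed
    have s2: "summable (\<lambda>n. norm (jterm s x (- int (Suc n))))"
      using summable_norm_jterm(2)[OF s(2), of x] by (subst summable_Suc_iff)
    have "(\<lambda>N. jprod s x N) \<longlonglongrightarrow> (\<Sum>n. 1 / L * jterm s x (int n)) + (\<Sum>n. 1 / L * jterm s x (- int (Suc n)))"
      unfolding jprod_conv_central_sums[OF s x]
      using tannery[OF summable_norm_jterm(1)[OF s(2)], of "\<lambda>n. n" x] tannery[OF s2, of Suc]
      by (intro tendsto_add) auto
    moreover have "(\<Sum>n. 1 / L * jterm s x (int n)) + (\<Sum>n. 1 / L * jterm s x (- int (Suc n))) = 1 / L * jtheta s x"
      using summable_norm_cancel[OF summable_norm_jterm(1)[OF s(2)]] summable_norm_cancel[OF s2]
      by (simp only: jtheta_conv_suminf[OF s(2)] suminf_mult distrib_left)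
    ultimately show ?thesis by simp
  qed
  thus thesis using that[of "1 / L"] L by auto
qed

text \<open>
  An absolutely convergent product vanishes only if one of its factors does.
\<close>
lemma jtheta_zeroE:
  assumes s: "s \<noteq> 0" "norm s < 1" and x: "x \<noteq> 0" and zero: "jtheta s x = 0"
  obtains m where "s ^ (2 * m + 1) * x = -1 \<or> s ^ (2 * m + 1) = - x"
proof (rule ccontr)
  assume contra: "\<not> thesis"
  define f where "f = (\<lambda>m. 1 + s ^ (2 * m + 1) * x)"
  define g where "g = (\<lambda>m. 1 + s ^ (2 * m + 1) / x)"
  have nz: "f m \<noteq> 0" "g m \<noteq> 0" for m
    using contra that[of m] x
    by (auto simp: f_def g_def field_simps eq_neg_iff_add_eq_0 add.commute)
  have summ: "summable (\<lambda>m. norm (s ^ (2 * m + 1) * c))" for c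
  proof -
    have "summable (\<lambda>m. (norm s ^ 2) ^ m * (norm s * norm c))"
      using s by (intro summable_mult2 summable_geometric) (simp add: power_less_one_iff)
    moreover have "(norm s ^ 2) ^ m * (norm s * norm c) = norm (s ^ (2 * m + 1) * c)" for m
      by (simp add: norm_mult norm_power flip: power_mult)
    ultimately show ?thesis by simp
  qed
  have conv: "convergent_prod f" "convergent_prod g"
    unfolding f_def g_def
    using summ[of x] summ[of "inverse x"]
    by (auto intro!: abs_convergent_prod_imp_convergent_prod
             simp: abs_convergent_prod_conv_summable field_simps)
  obtain C where C: "C \<noteq> 0" "jprod s x \<longlonglongrightarrow> C * jtheta s x"
    using jacobi_triple_product[OF s] x by metis
  have "jprod s x = (\<lambda>N. (\<Prod>m<N. f m) * (\<Prod>m<N. g m))"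
    by (simp add: jprod_def f_def g_def prod.distrib fun_eq_iff)
  moreover have "(\<lambda>N. (\<Prod>m<N. f m) * (\<Prod>m<N. g m)) \<longlonglongrightarrow> prodinf f * prodinf g"
    using convergent_prod_LIMSEQ[OF conv(1)] convergent_prod_LIMSEQ[OF conv(2)]
    unfolding LIMSEQ_lessThan_iff_atMost[symmetric] by (rule tendsto_mult)
  ultimately have "C * jtheta s x = prodinf f * prodinf g"
    using C LIMSEQ_unique by metis
  moreover have "prodinf f \<noteq> 0" "prodinf g \<noteq> 0"
    using prodinf_nonzero[OF conv(1) nz(1)] prodinf_nonzero[OF conv(2) nz(2)] .
  ultimately show False using zero by simp
qed

section \<open>Powers of q and the zeros of the theta functions\<close>

lemma qpow_add: "qpow \<tau> (a + b) = qpow \<tau> a * qpow \<tau> b"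
  by (simp add: qpow_def exp_add [symmetric] algebra_simps)

lemma qpow_0 [simp]: "qpow \<tau> 0 = 1"
  by (simp add: qpow_def)

lemma qpow_nonzero [simp]: "qpow \<tau> a \<noteq> 0"
  by (simp add: qpow_def)

lemma qpow_power: "qpow \<tau> a ^ n = qpow \<tau> (of_nat n * a)"
  by (simp add: qpow_def exp_of_nat_mult [symmetric] mult_ac)

lemma qpow_powi: "qpow \<tau> a powi m = qpow \<tau> (of_int m * a)"
  by (simp add: qpow_def exp_power_int mult_ac)

lemma qpow_of_nat_mult_tau: "qpow (of_nat n * \<tau>) a = qpow \<tau> a ^ n"
  by (simp add: qpow_def exp_of_nat_mult [symmetric] mult_ac)

lemma norm_qpow: "norm (qpow \<tau> a) = exp (- 2 * pi * a * Im \<tau>)"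
  by (simp add: qpow_def)

lemma norm_qpow_less_1: "Im \<tau> > 0 \<Longrightarrow> a > 0 \<Longrightarrow> norm (qpow \<tau> a) < 1"
  by (simp add: norm_qpow)

lemma exp_powi_2i: "exp (2 * \<i> * v) powi m = exp (of_int (2 * m) * \<i> * v)"
  by (simp add: exp_power_int mult_ac)

lemma qpow_square: "qpow \<tau> ((of_int m)\<^sup>2) = qpow \<tau> 1 ^ nat (m\<^sup>2)"
  by (simp add: qpow_power)

lemma theta3_term_conv_jterm:
  "qpow \<tau> ((of_int m)\<^sup>2) * exp (of_int (2*m) * \<i> * v) = jterm (qpow \<tau> 1) (exp (2 * \<i> * v)) m"
  unfolding jterm_def exp_powi_2i qpow_square ..

lemma theta2_term_conv_jterm:
  "qpow \<tau> ((of_int m + 1/2)\<^sup>2) * exp (of_int (2*m + 1) * \<i> * v) =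
   qpow \<tau> (1/4) * exp (\<i> * v) * jterm (qpow \<tau> 1) (qpow \<tau> 1 * exp (2 * \<i> * v)) m"
proof -
  have "(of_int m + 1/2 :: real)\<^sup>2 = (of_int m)\<^sup>2 + of_int m * 1 + 1/4"
    by (simp add: power2_eq_square algebra_simps)
  hence "qpow \<tau> ((of_int m + 1/2)\<^sup>2) = qpow \<tau> 1 ^ nat (m\<^sup>2) * qpow \<tau> 1 powi m * qpow \<tau> (1/4)"
    by (simp only: qpow_add qpow_square qpow_powi)
  moreover have "exp (of_int (2*m + 1) * \<i> * v) = exp (2 * \<i> * v) powi m * exp (\<i> * v)"
    unfolding exp_powi_2i by (simp add: exp_add [symmetric] algebra_simps)
  ultimately show ?thesis
    by (simp add: jterm_def power_int_mult_distrib mult_ac)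
qed

lemma theta3_conv_jtheta: "theta3 v \<tau> = jtheta (qpow \<tau> 1) (exp (2 * \<i> * v))"
  unfolding theta3_def jtheta_def theta3_term_conv_jterm ..

lemma theta2_conv_jtheta:
  "theta2 v \<tau> = qpow \<tau> (1/4) * exp (\<i> * v) * jtheta (qpow \<tau> 1) (qpow \<tau> 1 * exp (2 * \<i> * v))"
  unfolding theta2_def jtheta_def theta2_term_conv_jterm infsum_cmult_right' ..

lemma theta_terms_abs_summable:
  assumes "Im \<tau> > 0"
  shows "(\<lambda>m. norm (qpow \<tau> ((of_int m)\<^sup>2) * exp (of_int (2*m) * \<i> * v))) summable_on UNIV"
    and "(\<lambda>m. norm (qpow \<tau> ((of_int m + 1/2)\<^sup>2) * exp (of_int (2*m+1) * \<i> * v))) summable_on UNIV"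
proof -
  have q: "norm (qpow \<tau> 1) < 1" using norm_qpow_less_1[OF assms, of 1] by simp
  show "(\<lambda>m. norm (qpow \<tau> ((of_int m)\<^sup>2) * exp (of_int (2*m) * \<i> * v))) summable_on UNIV"
    unfolding theta3_term_conv_jterm using q by (rule jterm_abs_summable)
  show "(\<lambda>m. norm (qpow \<tau> ((of_int m + 1/2)\<^sup>2) * exp (of_int (2*m+1) * \<i> * v))) summable_on UNIV"
    unfolding theta2_term_conv_jterm norm_mult[of "_ * _" "jterm _ _ _"]
    by (intro summable_on_cmult_right jterm_abs_summable q)
qed

text \<open>
  By the triple product the zeros of \<open>\<theta>\<^sub>3\<close> satisfy \<open>e^(2iv) = -q^(odd)\<close>, and since \<open>\<theta>\<^sub>2\<close> is essentially
  \<open>\<theta>\<^sub>3\<close> at \<open>v + \<pi>\<tau>\<close>, those of \<open>\<theta>\<^sub>2\<close> satisfy \<open>e^(2iv) = -q^(even)\<close>. Comparing absolute values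
  excludes real zeros of \<open>\<theta>\<^sub>3\<close> and common zeros of the two functions.
\<close>
lemma theta3_zeroE:
  assumes "Im \<tau> > 0" "theta3 v \<tau> = 0"
  obtains m where "qpow \<tau> (2 * of_int m + 1) = - exp (2 * \<i> * v)"
proof -
  have q: "norm (qpow \<tau> 1) < 1" using norm_qpow_less_1[OF assms(1), of 1] by simp
  obtain m where "qpow \<tau> 1 ^ (2 * m + 1) * exp (2 * \<i> * v) = -1 \<or> qpow \<tau> 1 ^ (2 * m + 1) = - exp (2 * \<i> * v)"
    using jtheta_zeroE[of "qpow \<tau> 1" "exp (2 * \<i> * v)"] q assms(2) by (auto simp: theta3_conv_jtheta)
  thus thesis
  proof
    assume *: "qpow \<tau> 1 ^ (2 * m + 1) * exp (2 * \<i> * v) = -1"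
    have "qpow \<tau> 1 ^ (2 * m + 1) * qpow \<tau> (2 * of_int (- int m - 1) + 1) = 1"
      unfolding qpow_power qpow_add[symmetric] by simp
    with * have "qpow \<tau> 1 ^ (2 * m + 1) * (qpow \<tau> (2 * of_int (- int m - 1) + 1) + exp (2 * \<i> * v)) = 0"
      by (simp only: distrib_left) simp
    hence "qpow \<tau> (2 * of_int (- int m - 1) + 1) + exp (2 * \<i> * v) = 0"
      by (simp only: mult_eq_0_iff) simp
    hence "qpow \<tau> (2 * of_int (- int m - 1) + 1) = - exp (2 * \<i> * v)"
      by (simp only: eq_neg_iff_add_eq_0)
    thus thesis by (rule that)
  next
    assume "qpow \<tau> 1 ^ (2 * m + 1) = - exp (2 * \<i> * v)"
    hence "qpow \<tau> (2 * of_int (int m) + 1) = - exp (2 * \<i> * v)"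
      unfolding qpow_power by (simp add: algebra_simps)
    thus thesis by (rule that)
  qed
qed

lemma qpow_eq_norm_1D:
  assumes "Im \<tau> > 0" "norm (qpow \<tau> a) = 1"
  shows "a = 0"
  using assms by (simp add: norm_qpow)

lemma theta3_real_nonzero:
  assumes "Im \<tau> > 0"
  shows "theta3 (of_real x) \<tau> \<noteq> 0"
proof
  assume "theta3 (of_real x) \<tau> = 0"
  then obtain m where m: "qpow \<tau> (2 * of_int m + 1) = - exp (2 * \<i> * of_real x)"
    using theta3_zeroE[OF assms] by blast
  have "norm (qpow \<tau> (2 * of_int m + 1)) = 1" unfolding m by simp
  hence "2 * of_int m + 1 = (0 :: real)" by (rule qpow_eq_norm_1D[OF assms])
  hence "of_int (2 * m + 1) = (of_int 0 :: real)" by simp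
  hence "2 * m + 1 = 0" by (simp only: of_int_eq_iff)
  thus False by presburger
qed

lemma theta2_conv_theta3:
  "theta2 v \<tau> = qpow \<tau> (1/4) * exp (\<i> * v) * theta3 (v + of_real pi * \<tau>) \<tau>"
proof -
  have "exp (2 * \<i> * (v + of_real pi * \<tau>)) = qpow \<tau> 1 * exp (2 * \<i> * v)"
    by (simp add: qpow_def exp_add [symmetric] algebra_simps)
  thus ?thesis by (simp add: theta2_conv_jtheta theta3_conv_jtheta)
qed

lemma theta2_0_nonzero:
  assumes "Im \<tau> > 0"
  shows "theta2 0 \<tau> \<noteq> 0"
proof
  assume "theta2 0 \<tau> = 0"
  hence "theta3 (of_real pi * \<tau>) \<tau> = 0" by (simp add: theta2_conv_theta3)
  then obtain m where m: "qpow \<tau> (2 * of_int m + 1) = - exp (2 * \<i> * (of_real pi * \<tau>))"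
    using theta3_zeroE[OF assms] by blast
  have "exp (2 * \<i> * (of_real pi * \<tau>)) = qpow \<tau> 1" by (simp add: qpow_def mult_ac)
  with m have "qpow \<tau> (2 * of_int m) * qpow \<tau> 1 = - 1 * qpow \<tau> 1"
    by (simp add: qpow_add)
  hence eq: "qpow \<tau> (2 * of_int m) = - 1"
    by (simp only: mult_right_cancel[OF qpow_nonzero])
  hence "norm (qpow \<tau> (2 * of_int m)) = 1" by simp
  hence "2 * of_int m = (0::real)" by (rule qpow_eq_norm_1D[OF assms])
  with eq show False by simp
qed

lemma theta2_theta3_no_common_zero:
  assumes "Im \<tau> > 0"
  shows "theta2 v \<tau> \<noteq> 0 \<or> theta3 v \<tau> \<noteq> 0"
proof (rule ccontr)
  assume "\<not> ?thesis"
  hence z: "theta3 v \<tau> = 0" "theta3 (v + of_real pi * \<tau>) \<tau> = 0"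
    by (auto simp: theta2_conv_theta3)
  obtain m where m: "qpow \<tau> (2 * of_int m + 1) = - exp (2 * \<i> * v)"
    using theta3_zeroE[OF assms z(1)] .
  obtain l where l: "qpow \<tau> (2 * of_int l + 1) = - exp (2 * \<i> * (v + of_real pi * \<tau>))"
    using theta3_zeroE[OF assms z(2)] .
  have "exp (2 * \<i> * (v + of_real pi * \<tau>)) = qpow \<tau> 1 * exp (2 * \<i> * v)"
    by (simp add: qpow_def exp_add [symmetric] algebra_simps)
  with l m have "qpow \<tau> (2 * of_int l + 1) = qpow \<tau> 1 * qpow \<tau> (2 * of_int m + 1)" by simp
  hence "qpow \<tau> (2 * of_int l) = qpow \<tau> (2 * of_int m + 1)"
    by (simp add: qpow_add)
  moreover have "qpow \<tau> (2 * of_int l) = qpow \<tau> (2 * of_int l - (2 * of_int m + 1)) * qpow \<tau> (2 * of_int m + 1)"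
    by (simp flip: qpow_add)
  ultimately have "qpow \<tau> (2 * of_int l - (2 * of_int m + 1)) = 1" by simp
  hence "2 * of_int l - (2 * of_int m + 1) = (0::real)"
    by (intro qpow_eq_norm_1D[OF assms]) simp
  hence "of_int (2 * l - (2 * m + 1)) = (of_int 0 :: real)" by simp
  hence "2 * l - (2 * m + 1) = 0" by (simp only: of_int_eq_iff)
  thus False by presburger
qed

section \<open>Symmetries and quasi-periods\<close>

lemma theta3_add_pi: "theta3 (v + of_real pi) \<tau> = theta3 v \<tau>"
proof -
  have "exp (2 * \<i> * (v + of_real pi)) = exp (2 * \<i> * v)"
    using exp_plus_2pin[of "2 * \<i> * v" 1] by (simp add: algebra_simps)
  thus ?thesis by (simp add: theta3_conv_jtheta)
qed

lemma theta2_add_pi: "theta2 (v + of_real pi) \<tau> = - theta2 v \<tau>"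
proof -
  have "exp (\<i> * (v + of_real pi)) = - exp (\<i> * v)"
    by (simp add: exp_add algebra_simps)
  moreover have "theta3 (v + of_real pi + of_real pi * \<tau>) \<tau> = theta3 (v + of_real pi * \<tau>) \<tau>"
    using theta3_add_pi[of "v + of_real pi * \<tau>" \<tau>] by (simp add: add_ac)
  ultimately show ?thesis by (simp add: theta2_conv_theta3)
qed

lemma theta3_minus: "theta3 (- v) \<tau> = theta3 v \<tau>"
  unfolding theta3_def
  by (rule infsum_reindex_bij_witness[of _ "\<lambda>m. - m" "\<lambda>m. - m"]) (auto simp: algebra_simps)

lemma theta2_minus: "theta2 (- v) \<tau> = theta2 v \<tau>"
  unfolding theta2_def
  by (rule infsum_reindex_bij_witness[of _ "\<lambda>m. - m - 1" "\<lambda>m. - m - 1"])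
     (auto simp: algebra_simps power2_eq_square)

lemma theta3_add_2pi_tau:
  "theta3 (v + 2 * of_real pi * \<tau>) \<tau> = qpow \<tau> (- 1) * exp (- 2 * \<i> * v) * theta3 v \<tau>"
proof -
  have *: "qpow \<tau> ((of_int m)\<^sup>2) * exp (of_int (2 * m) * \<i> * (v + 2 * of_real pi * \<tau>)) =
    qpow \<tau> (- 1) * exp (- 2 * \<i> * v) *
     (qpow \<tau> ((of_int (m + 1))\<^sup>2) * exp (of_int (2 * (m + 1)) * \<i> * v))" for m
    by (simp add: qpow_def exp_add [symmetric] algebra_simps power2_eq_square)
  have "theta3 (v + 2 * of_real pi * \<tau>) \<tau> = qpow \<tau> (- 1) * exp (- 2 * \<i> * v) *
     (\<Sum>\<^sub>\<infinity>m. qpow \<tau> ((of_int (m + 1))\<^sup>2) * exp (of_int (2 * (m + 1)) * \<i> * v))"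
    unfolding theta3_def * infsum_cmult_right' ..
  also have "(\<Sum>\<^sub>\<infinity>m. qpow \<tau> ((of_int (m + 1))\<^sup>2) * exp (of_int (2 * (m + 1)) * \<i> * v)) = theta3 v \<tau>"
    unfolding theta3_def by (rule infsum_reindex_bij_witness[of _ "\<lambda>m. m - 1" "\<lambda>m. m + 1"]) auto
  finally show ?thesis .
qed

lemma theta2_add_2pi_tau:
  "theta2 (v + 2 * of_real pi * \<tau>) \<tau> = qpow \<tau> (- 1) * exp (- 2 * \<i> * v) * theta2 v \<tau>"
proof -
  have "v + 2 * of_real pi * \<tau> + of_real pi * \<tau> = (v + of_real pi * \<tau>) + 2 * of_real pi * \<tau>"
    "\<i> * (v + 2 * of_real pi * \<tau>) = \<i> * v + 2 * \<i> * of_real pi * \<tau>"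
    by (simp_all add: algebra_simps)
  hence "theta2 (v + 2 * of_real pi * \<tau>) \<tau> =
    qpow \<tau> (1/4) * exp (\<i> * v + 2 * \<i> * of_real pi * \<tau>) * theta3 ((v + of_real pi * \<tau>) + 2 * of_real pi * \<tau>) \<tau>"
    by (simp only: theta2_conv_theta3)
  also have "\<dots> = (exp (2 * \<i> * of_real pi * \<tau>) * exp (- 2 * \<i> * (v + of_real pi * \<tau>))) *
      (qpow \<tau> (1/4) * exp (\<i> * v) * qpow \<tau> (- 1) * theta3 (v + of_real pi * \<tau>) \<tau>)"
    unfolding theta3_add_2pi_tau by (simp add: exp_add mult_ac)
  also have "exp (2 * \<i> * of_real pi * \<tau>) * exp (- 2 * \<i> * (v + of_real pi * \<tau>)) = exp (- 2 * \<i> * v)"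
    by (simp add: exp_add [symmetric] algebra_simps)
  finally show ?thesis by (simp add: theta2_conv_theta3 mult_ac)
qed

section \<open>Holomorphy in the argument\<close>

text \<open>
  The coefficients \<open>s^(n\<^sup>2)\<close> form an entire power series \<open>G\<close>, and the bilateral series is
  \<open>G(x) + G(1/x) - 1\<close>.
\<close>
lemma jtheta_holomorphic:
  assumes "norm s < 1"
  shows "jtheta s holomorphic_on - {0}"
proof -
  define G where "G = Abs_fps (\<lambda>n. s ^ n\<^sup>2)"
  have summ: "summable (\<lambda>n. s ^ n\<^sup>2 * z ^ n)" for z
    by (rule summable_norm_cancel) (simp add: norm_mult norm_power summable_square_powers assms)
  have radius: "fps_conv_radius G = \<infinity>"
    unfolding fps_conv_radius_def G_def by (rule conv_radius_inftyI'') (simp add: summ)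
  have eq: "jtheta s x = eval_fps G x + (eval_fps G (inverse x) - 1)" if "x \<noteq> 0" for x
  proof -
    have 1: "jterm s x (int n) = s ^ n\<^sup>2 * x ^ n" "jterm s x (- int n) = s ^ n\<^sup>2 * inverse x ^ n" for n
      by (simp_all add: jterm_def power_int_minus power_inverse flip: of_nat_power)
    have 2: "(\<Sum>n. s ^ (Suc n)\<^sup>2 * inverse x ^ Suc n) = eval_fps G (inverse x) - 1"
      using suminf_split_head[OF summ[of "inverse x"]] by (simp add: eval_fps_def G_def)
    show ?thesis
      unfolding jtheta_conv_suminf[OF assms] 1 2 by (simp add: eval_fps_def G_def)
  qed
  have "(\<lambda>x. eval_fps G x + (eval_fps G (inverse x) - 1)) holomorphic_on - {0}"
  proof (intro holomorphic_on_add holomorphic_on_diff holomorphic_on_const)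
    show "eval_fps G holomorphic_on - {0}"
      by (rule holomorphic_on_eval_fps) (simp add: radius)
    have "eval_fps G \<circ> inverse holomorphic_on - {0}"
      by (rule holomorphic_on_compose_gen[where t = UNIV])
         (auto intro!: holomorphic_intros simp: radius)
    thus "(\<lambda>x. eval_fps G (inverse x)) holomorphic_on - {0}" by (simp add: o_def)
  qed
  thus ?thesis using eq by (subst holomorphic_cong[OF refl, of _ _ "\<lambda>x. eval_fps G x + (eval_fps G (inverse x) - 1)"]) auto
qed

lemma theta3_holomorphic:
  assumes "Im \<tau> > 0"
  shows "(\<lambda>v. theta3 v \<tau>) holomorphic_on UNIV"
proof -
  have q: "norm (qpow \<tau> 1) < 1" using norm_qpow_less_1[OF assms, of 1] by simp
  have "(\<lambda>v. exp (2 * \<i> * v)) holomorphic_on UNIV"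
    by (intro holomorphic_intros)
  moreover have "(\<lambda>v. exp (2 * \<i> * v)) ` UNIV \<subseteq> - {0}"
    by auto
  ultimately have "jtheta (qpow \<tau> 1) \<circ> (\<lambda>v. exp (2 * \<i> * v)) holomorphic_on UNIV"
    by (rule holomorphic_on_compose_gen[OF _ jtheta_holomorphic[OF q]])
  thus ?thesis unfolding theta3_conv_jtheta o_def .
qed

lemma theta2_holomorphic:
  assumes "Im \<tau> > 0"
  shows "(\<lambda>v. theta2 v \<tau>) holomorphic_on UNIV"
proof -
  have "(\<lambda>v. theta3 v \<tau>) \<circ> (\<lambda>v. v + of_real pi * \<tau>) holomorphic_on UNIV"
    by (rule holomorphic_on_compose_gen[OF _ theta3_holomorphic[OF assms]])
       (auto intro!: holomorphic_intros)
  thus ?thesis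
    unfolding theta2_conv_theta3 o_def by (intro holomorphic_intros)
qed

section \<open>Surjectivity of the theta quotient\<close>

text \<open>
  All values are attained on a compact period parallelogram, so Liouville's theorem applies.
\<close>
lemma doubly_periodic_holomorphic_imp_constant:
  assumes holo: "g holomorphic_on UNIV"
    and p1: "\<And>v. g (v + of_real a) = g v" and a: "a > 0"
    and p2: "\<And>v. g (v + \<omega>) = g v" and \<omega>: "Im \<omega> > 0"
  shows "g v = g w"
proof -
  have p1i: "g (v + of_int m * of_real a) = g v" for v m
  proof (induction m rule: int_induct[of _ 0])
    case (step1 m)
    thus ?case using p1[of "v + of_int m * of_real a"] by (simp add: algebra_simps)
  next
    case (step2 m)
    thus ?case using p1[of "v + of_int (m - 1) * of_real a"] by (simp add: algebra_simps)
  qed auto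
  have p2i: "g (v + of_int m * \<omega>) = g v" for v m
  proof (induction m rule: int_induct[of _ 0])
    case (step1 m)
    thus ?case using p2[of "v + of_int m * \<omega>"] by (simp add: algebra_simps)
  next
    case (step2 m)
    thus ?case using p2[of "v + of_int (m - 1) * \<omega>"] by (simp add: algebra_simps)
  qed auto
  define K where "K = (\<lambda>(s, t). of_real s + of_real t * \<omega>) ` ({0..a} \<times> {0..1::real})"
  have "compact K"
    unfolding K_def case_prod_unfold
    by (intro compact_continuous_image continuous_intros compact_Times) auto
  hence "compact (g ` K)"
    using holo by (intro compact_continuous_image holomorphic_on_imp_continuous_on) (auto intro: holomorphic_on_subset)
  moreover have "range g \<subseteq> g ` K"
  proof safe
    fix z :: complex
    define t where "t = Im z / Im \<omega>"
    define s where "s = Re z - t * Re \<omega>"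
    have z: "z = of_real s + of_real t * \<omega>"
      using \<omega> by (simp add: complex_eq_iff s_def t_def)
    define s' where "s' = s - of_int \<lfloor>s / a\<rfloor> * a"
    define t' where "t' = t - of_int \<lfloor>t\<rfloor>"
    have "s' \<in> {0..a}"
    proof -
      have "of_int \<lfloor>s / a\<rfloor> \<le> s / a" "s / a \<le> of_int \<lfloor>s / a\<rfloor> + 1" by linarith+
      hence "of_int \<lfloor>s / a\<rfloor> * a \<le> s" "s \<le> (of_int \<lfloor>s / a\<rfloor> + 1) * a"
        by (simp_all only: pos_le_divide_eq[OF a] pos_divide_le_eq[OF a])
      thus ?thesis by (simp add: s'_def algebra_simps)
    qed
    moreover have "t' \<in> {0..1}" unfolding t'_def by (simp, linarith)
    ultimately have "of_real s' + of_real t' * \<omega> \<in> K" unfolding K_def by force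
    moreover have "z = (of_real s' + of_real t' * \<omega> + of_int \<lfloor>s / a\<rfloor> * of_real a) + of_int \<lfloor>t\<rfloor> * \<omega>"
      by (simp add: z s'_def t'_def algebra_simps)
    hence "g z = g (of_real s' + of_real t' * \<omega>)"
      by (simp only: p1i p2i)
    ultimately show "g z \<in> g ` K" by blast
  qed
  ultimately have "bounded (range g)"
    using bounded_subset compact_imp_bounded by blast
  hence "g constant_on UNIV" using holo by (rule Liouville_theorem[rotated])
  thus ?thesis by (auto simp: constant_on_def)
qed

text \<open>
  If the value \<open>z\<close> were omitted, then \<open>\<theta>\<^sub>3 / (\<theta>\<^sub>2 - z \<theta>\<^sub>3)\<close> would be entire and doubly periodic, hence
  constant. But a shift by \<open>\<pi>\<close> changes the sign of \<open>\<theta>\<^sub>2\<close> and fixes \<open>\<theta>\<^sub>3\<close>, and neither of them vanishes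
  at \<open>0\<close>.
\<close>
lemma theta_quotient_surj:
  assumes "Im \<tau> > 0"
  obtains u where "theta3 u \<tau> \<noteq> 0" "theta2 u \<tau> / theta3 u \<tau> = z"
proof -
  have "\<exists>u. theta2 u \<tau> - z * theta3 u \<tau> = 0"
  proof (rule ccontr)
    assume "\<nexists>u. theta2 u \<tau> - z * theta3 u \<tau> = 0"
    hence nz: "theta2 u \<tau> - z * theta3 u \<tau> \<noteq> 0" for u by blast
    define g where "g = (\<lambda>u. theta3 u \<tau> / (theta2 u \<tau> - z * theta3 u \<tau>))"
    have holo: "g holomorphic_on UNIV"
      unfolding g_def using nz by (intro holomorphic_intros theta2_holomorphic theta3_holomorphic assms) auto
    have p1: "g (v + of_real (2 * pi)) = g v" for v
    proof -
      have "v + of_real (2 * pi) = (v + of_real pi) + of_real pi" by simp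
      thus ?thesis unfolding g_def by (simp only: theta3_add_pi theta2_add_pi minus_minus)
    qed
    have p2: "g (v + 2 * of_real pi * \<tau>) = g v" for v
    proof -
      have "g (v + 2 * of_real pi * \<tau>) = (qpow \<tau> (- 1) * exp (- 2 * \<i> * v) * theta3 v \<tau>) /
              (qpow \<tau> (- 1) * exp (- 2 * \<i> * v) * (theta2 v \<tau> - z * theta3 v \<tau>))"
        unfolding g_def theta3_add_2pi_tau theta2_add_2pi_tau by (simp add: algebra_simps)
      also have "\<dots> = g v" by (simp add: g_def)
      finally show ?thesis .
    qed
    have const: "g v = g w" for v w
      using doubly_periodic_holomorphic_imp_constant[OF holo p1 _ p2] assms by simp
    have t: "theta3 0 \<tau> \<noteq> 0" "theta2 0 \<tau> \<noteq> 0"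
      using theta3_real_nonzero[OF assms, of 0] theta2_0_nonzero[OF assms] by auto
    have "g 0 = g (0 + of_real pi)" by (rule const)
    hence "theta3 0 \<tau> / (theta2 0 \<tau> - z * theta3 0 \<tau>) = theta3 0 \<tau> / (- theta2 0 \<tau> - z * theta3 0 \<tau>)"
      unfolding g_def theta3_add_pi theta2_add_pi .
    moreover have "- theta2 0 \<tau> - z * theta3 0 \<tau> \<noteq> 0"
      using nz[of "0 + of_real pi"] unfolding theta3_add_pi theta2_add_pi .
    ultimately have "theta3 0 \<tau> * (- theta2 0 \<tau> - z * theta3 0 \<tau>) = theta3 0 \<tau> * (theta2 0 \<tau> - z * theta3 0 \<tau>)"
      using nz[of 0] by (simp only: frac_eq_eq not_False_eq_True)
    hence "- theta2 0 \<tau> = theta2 0 \<tau>"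
      unfolding mult_left_cancel[OF t(1)] by simp
    with t show False by simp
  qed
  then obtain u where u: "theta2 u \<tau> - z * theta3 u \<tau> = 0" by blast
  hence "theta3 u \<tau> \<noteq> 0" using theta2_theta3_no_common_zero[OF assms, of u] by auto
  with u show thesis by (intro that[of u]) (auto simp: field_simps)
qed

section \<open>Multiplication of the argument\<close>

text \<open>
  Shifts spaced by \<open>\<pi>/n\<close> and centred at \<open>0\<close>. The numbers \<open>e^(2i theta_shift n k)\<close> are the negatives
  of the \<open>n\<close>-th roots of \<open>-1\<close>, and their being symmetric about \<open>0\<close> makes all phase factors in the
  multiplication formula for \<open>\<theta>\<^sub>2\<close> cancel.
\<close>
definition theta_shift :: "nat \<Rightarrow> nat \<Rightarrow> real" where
  "theta_shift n k = (2 * real k - 1) * pi / (2 * real n) - pi / 2"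

lemma prod_minus_roots_of_unity:
  fixes y :: complex
  assumes "n > 0"
  shows "(\<Prod>k<n. y - cis (2 * pi * real k / real n)) = y ^ n - 1"
proof -
  define P where "P = (\<Prod>k<n. [:- cis (2 * pi * real k / real n), 1:])"
  define Q where "Q = monom 1 n - (1 :: complex poly)"
  have deg: "degree P = n"
    unfolding P_def by (subst degree_prod_eq_sum_degree) auto
  have "P = Q"
  proof (rule poly_eqI_degree_lead_coeff)
    have "lead_coeff P = 1"
      unfolding P_def by (simp add: lead_coeff_prod)
    thus "coeff P n = coeff Q n"
      using assms by (simp add: Q_def deg)
    show "card {z::complex. z ^ n = 1} \<ge> n"
      using card_roots_unity_eq[OF assms] by simp
    show "degree Q \<le> n"
      unfolding Q_def by (intro degree_diff_le) (auto simp: degree_monom_le)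
    fix z :: complex assume "z \<in> {z. z ^ n = 1}"
    with Complex.bij_betw_roots_unity[OF assms] obtain k where "k < n" "z = cis (2 * pi * real k / real n)"
      unfolding bij_betw_def by auto
    hence "poly P z = 0"
      by (auto simp: P_def poly_prod prod_zero_iff)
    thus "poly P z = poly Q z"
      using \<open>z \<in> _\<close> by (simp add: Q_def poly_monom)
  qed (simp add: deg)
  hence "poly P y = poly Q y" by simp
  thus ?thesis by (simp add: P_def Q_def poly_prod poly_monom)
qed

lemma theta_shift_reflect: "1 \<le> k \<Longrightarrow> k \<le> n \<Longrightarrow> theta_shift n (n + 1 - k) = - theta_shift n k"
  by (simp add: theta_shift_def field_simps of_nat_diff)

lemma prod_one_plus_theta_shift:
  assumes "n > 0"
  shows "(\<Prod>k=1..n. 1 + Y * exp (2 * \<i> * of_real (theta_shift n k))) = 1 + Y ^ n"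
proof (cases "Y = 0")
  case False
  \<comment> \<open>A primitive \<open>2n\<close>-th root of unity with \<open>\<rho>^n = -1\<close> reduces roots of \<open>-1\<close> to roots of unity.\<close>
  define \<rho> where "\<rho> = cis (pi / n)"
  have \<rho>: "\<rho> ^ n = -1" using assms by (simp add: \<rho>_def Complex.DeMoivre)
  have [simp]: "\<rho> \<noteq> 0" by (simp add: \<rho>_def)
  have "(\<Prod>k=1..n. 1 + Y * exp (2 * \<i> * of_real (theta_shift n k))) =
        (\<Prod>k<n. Y * \<rho> * (1 / (Y * \<rho>) - cis (2 * pi * real k / real n)))"
  proof (rule prod.reindex_bij_witness[of _ Suc "\<lambda>k. k - 1"], goal_cases)
    case (5 k)
    define j where "j = k - 1"
    have k: "k = Suc j" using 5 by (simp add: j_def)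
    have "2 * theta_shift n k = pi / n + 2 * pi * real j / n - pi"
      using assms by (simp add: theta_shift_def k field_simps)
    moreover have "2 * \<i> * of_real (theta_shift n k) = \<i> * of_real (2 * theta_shift n k)" by simp
    ultimately have "exp (2 * \<i> * of_real (theta_shift n k)) = cis (pi / n + 2 * pi * real j / n - pi)"
      by (simp only: cis_conv_exp)
    also have "\<dots> = - (\<rho> * cis (2 * pi * real j / real n))"
      by (simp add: \<rho>_def cis_mult flip: cis_divide)
    finally show ?case unfolding j_def[symmetric] using False by (simp add: field_simps)
  qed auto
  also have "\<dots> = (Y * \<rho>) ^ n * ((1 / (Y * \<rho>)) ^ n - 1)"
    using prod_minus_roots_of_unity[OF assms] by (simp add: prod.distrib)
  also have "\<dots> = 1 + Y ^ n"
    using False by (simp add: \<rho> power_divide power_mult_distrib field_simps)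
  finally show ?thesis .
qed (use assms in \<open>simp add: power_0_left\<close>)

lemma prod_one_plus_theta_shift':
  assumes "n > 0"
  shows "(\<Prod>k=1..n. 1 + Y / exp (2 * \<i> * of_real (theta_shift n k))) = 1 + Y ^ n"
proof -
  have "(\<Prod>k=1..n. 1 + Y / exp (2 * \<i> * of_real (theta_shift n k))) =
        (\<Prod>k=1..n. 1 + Y * exp (2 * \<i> * of_real (theta_shift n k)))"
  proof (rule prod.reindex_bij_witness[of _ "\<lambda>k. n + 1 - k" "\<lambda>k. n + 1 - k"], goal_cases)
    case (5 k)
    hence "exp (2 * \<i> * of_real (theta_shift n (n + 1 - k))) = inverse (exp (2 * \<i> * of_real (theta_shift n k)))"
      by (simp add: theta_shift_reflect[unfolded Suc_eq_plus1[symmetric]] exp_minus del: of_real_minus) (simp add: exp_minus)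
    thus ?case by (simp add: field_simps)
  qed auto
  thus ?thesis using prod_one_plus_theta_shift[OF assms] by simp
qed

text \<open>
  Each factor \<open>1 + Y^n\<close> of the product for \<open>(s^n, x^n)\<close> splits over the \<open>n\<close>-th roots of \<open>-1\<close>, so the
  multiplication formula holds already for the finite products.
\<close>
lemma jprod_power:
  assumes "n > 0" "x \<noteq> 0"
  shows "jprod (s ^ n) (x ^ n) N = (\<Prod>k=1..n. jprod s (x * exp (2 * \<i> * of_real (theta_shift n k))) N)"
proof -
  define e where "e = (\<lambda>k. exp (2 * \<i> * of_real (theta_shift n k)))"
  have "(\<Prod>k=1..n. jprod s (x * e k) N) =
        (\<Prod>m<N. \<Prod>k=1..n. (1 + (s ^ (2 * m + 1) * x) * e k) * (1 + (s ^ (2 * m + 1) / x) / e k))"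
    unfolding jprod_def by (subst prod.swap) (simp add: mult.assoc)
  also have "\<dots> = (\<Prod>m<N. (1 + (s ^ (2 * m + 1) * x) ^ n) * (1 + (s ^ (2 * m + 1) / x) ^ n))"
    unfolding e_def
    by (simp only: prod.distrib prod_one_plus_theta_shift[OF assms(1)] prod_one_plus_theta_shift'[OF assms(1)])
  also have "\<dots> = jprod (s ^ n) (x ^ n) N"
    unfolding jprod_def
    by (simp add: power_mult_distrib power_divide mult.commute flip: power_mult power_Suc)
  finally show ?thesis by (simp add: e_def)
qed

lemma jtheta_power:
  assumes n: "n > 0" and s: "s \<noteq> 0" "norm s < 1"
  obtains c where "c \<noteq> 0" "\<And>x. x \<noteq> 0 \<Longrightarrow>
    jtheta (s ^ n) (x ^ n) = c * (\<Prod>k=1..n. jtheta s (x * exp (2 * \<i> * of_real (theta_shift n k))))"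
proof -
  have sn: "s ^ n \<noteq> 0" "norm (s ^ n) < 1"
    using s n by (auto simp: norm_power power_less_one_iff)
  obtain C where C: "C \<noteq> 0" "\<And>x. x \<noteq> 0 \<Longrightarrow> jprod s x \<longlonglongrightarrow> C * jtheta s x"
    using jacobi_triple_product[OF s] by blast
  obtain D where D: "D \<noteq> 0" "\<And>x. x \<noteq> 0 \<Longrightarrow> jprod (s ^ n) x \<longlonglongrightarrow> D * jtheta (s ^ n) x"
    using jacobi_triple_product[OF sn] by blast
  have "jtheta (s ^ n) (x ^ n) = C ^ n / D * (\<Prod>k=1..n. jtheta s (x * exp (2 * \<i> * of_real (theta_shift n k))))"
    if x: "x \<noteq> 0" for x
  proof -
    have "jprod (s ^ n) (x ^ n) \<longlonglongrightarrow> (\<Prod>k=1..n. C * jtheta s (x * exp (2 * \<i> * of_real (theta_shift n k))))"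
      unfolding jprod_power[OF n x, abs_def] by (intro tendsto_prod C) (use x in auto)
    moreover have "jprod (s ^ n) (x ^ n) \<longlonglongrightarrow> D * jtheta (s ^ n) (x ^ n)"
      by (rule D) (use x in auto)
    ultimately have "D * jtheta (s ^ n) (x ^ n) = (\<Prod>k=1..n. C * jtheta s (x * exp (2 * \<i> * of_real (theta_shift n k))))"
      using LIMSEQ_unique by blast
    thus ?thesis using D(1) by (simp add: prod.distrib field_simps)
  qed
  thus thesis using that[of "C ^ n / D"] C(1) D(1) by auto
qed

lemma sum_theta_shift:
  assumes "n > 0"
  shows "(\<Sum>k=1..n. theta_shift n k) = 0"
proof -
  have "(\<Sum>k=1..n. theta_shift n k) = (\<Sum>k=1..n. theta_shift n (n + 1 - k))"
    by (rule sum.reindex_bij_witness[of _ "\<lambda>k. n + 1 - k" "\<lambda>k. n + 1 - k"]) auto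
  also have "\<dots> = - (\<Sum>k=1..n. theta_shift n k)"
    by (subst sum_negf [symmetric]) (intro sum.cong refl theta_shift_reflect; simp)
  finally show ?thesis by simp
qed

text \<open>
  The two constants agree because \<open>\<theta>\<^sub>2(v)\<close> is, up to the factor \<open>q^(1/4) e^(iv)\<close>, the value of \<open>\<theta>\<^sub>3\<close>
  at \<open>v + \<pi>\<tau>\<close>, and those factors multiply up correctly since the shifts sum to \<open>0\<close>. The equality of
  the constants is what makes the quotient \<open>\<theta>\<^sub>2 / \<theta>\<^sub>3\<close> multiplicative.
\<close>
theorem theta_multiplication:
  assumes n: "n > 0" and \<tau>: "Im \<tau> > 0"
  obtains c where "c \<noteq> 0"
    "\<And>v. theta3 (of_nat n * v) (of_nat n * \<tau>) = c * (\<Prod>k=1..n. theta3 (v + of_real (theta_shift n k)) \<tau>)"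
    "\<And>v. theta2 (of_nat n * v) (of_nat n * \<tau>) = c * (\<Prod>k=1..n. theta2 (v + of_real (theta_shift n k)) \<tau>)"
proof -
  have q: "qpow \<tau> 1 \<noteq> 0" "norm (qpow \<tau> 1) < 1" using norm_qpow_less_1[OF \<tau>, of 1] by auto
  obtain c where c: "c \<noteq> 0" "\<And>x. x \<noteq> 0 \<Longrightarrow>
    jtheta (qpow \<tau> 1 ^ n) (x ^ n) = c * (\<Prod>k=1..n. jtheta (qpow \<tau> 1) (x * exp (2 * \<i> * of_real (theta_shift n k))))"
    using jtheta_power[OF n q] by blast
  have 3: "theta3 (of_nat n * v) (of_nat n * \<tau>) = c * (\<Prod>k=1..n. theta3 (v + of_real (theta_shift n k)) \<tau>)" for v
  proof -
    have "exp (2 * \<i> * (of_nat n * v)) = exp (2 * \<i> * v) ^ n"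
      by (simp add: exp_of_nat_mult [symmetric] mult_ac)
    thus ?thesis
      by (simp add: theta3_conv_jtheta qpow_of_nat_mult_tau c(2) ring_distribs exp_add)
  qed
  have 2: "theta2 (of_nat n * v) (of_nat n * \<tau>) = c * (\<Prod>k=1..n. theta2 (v + of_real (theta_shift n k)) \<tau>)" for v
  proof -
    have "(\<Prod>k=1..n. exp (\<i> * of_real (theta_shift n k))) = exp (\<i> * of_real (\<Sum>k=1..n. theta_shift n k))"
      by (simp add: exp_sum [symmetric] sum_distrib_left)
    hence one: "(\<Prod>k=1..n. exp (\<i> * of_real (theta_shift n k))) = 1"
      by (simp only: sum_theta_shift[OF n]) simp
    have *: "theta2 (v + of_real (theta_shift n k)) \<tau> = qpow \<tau> (1/4) * exp (\<i> * v) *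
      exp (\<i> * of_real (theta_shift n k)) * theta3 ((v + of_real pi * \<tau>) + of_real (theta_shift n k)) \<tau>" for k
      by (simp add: theta2_conv_theta3 ring_distribs exp_add add_ac)
    have "(\<Prod>k=1..n. theta2 (v + of_real (theta_shift n k)) \<tau>) =
          qpow \<tau> (1/4) ^ n * exp (\<i> * v) ^ n * (\<Prod>k=1..n. exp (\<i> * of_real (theta_shift n k))) *
          (\<Prod>k=1..n. theta3 ((v + of_real pi * \<tau>) + of_real (theta_shift n k)) \<tau>)"
      by (simp add: * prod.distrib power_mult_distrib)
    hence "c * (\<Prod>k=1..n. theta2 (v + of_real (theta_shift n k)) \<tau>) =
          qpow \<tau> (1/4) ^ n * exp (\<i> * v) ^ n * theta3 (of_nat n * (v + of_real pi * \<tau>)) (of_nat n * \<tau>)"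
      by (simp only: 3 one) simp
    also have "\<dots> = theta2 (of_nat n * v) (of_nat n * \<tau>)"
    proof -
      have "of_nat n * (v + of_real pi * \<tau>) = of_nat n * v + of_real pi * (of_nat n * \<tau>)"
        "exp (\<i> * v) ^ n = exp (\<i> * (of_nat n * v))"
        by (simp_all add: exp_of_nat_mult [symmetric] algebra_simps)
      thus ?thesis by (simp only: theta2_conv_theta3 qpow_of_nat_mult_tau)
    qed
    finally show ?thesis ..
  qed
  show thesis using that[OF c(1) 3 2] .
qed

section \<open>Addition formulas\<close>

lemma infsum_times:
  fixes f :: "'a \<Rightarrow> complex" and g :: "'b \<Rightarrow> complex"
  assumes "(\<lambda>x. norm (f x)) summable_on A" "(\<lambda>x. norm (g x)) summable_on B"
  shows "(\<lambda>(x, y). f x * g y) summable_on (A \<times> B)"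
    and "infsum f A * infsum g B = (\<Sum>\<^sub>\<infinity>(x, y)\<in>A \<times> B. f x * g y)"
proof -
  have "(\<lambda>(x, y). norm (f x) * norm (g y)) summable_on (A \<times> B)"
    using assms by (intro summable_on_SigmaI[where g = "\<lambda>x. norm (f x) * infsum (\<lambda>y. norm (g y)) B"])
      (auto intro!: has_sum_cmult_right has_sum_infsum summable_on_cmult_left)
  hence "(\<lambda>z. norm ((\<lambda>(x, y). f x * g y) z)) summable_on (A \<times> B)"
    by (simp add: case_prod_unfold norm_mult)
  thus *: "(\<lambda>(x, y). f x * g y) summable_on (A \<times> B)"
    by (rule abs_summable_summable)
  show "infsum f A * infsum g B = (\<Sum>\<^sub>\<infinity>(x, y)\<in>A \<times> B. f x * g y)"
    using infsum_Sigma'_banach[OF *] by (simp add: infsum_cmult_right' infsum_cmult_left')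
qed

text \<open>
  The lattice \<open>\<int>\<^sup>2\<close> of index pairs \<open>(m, l)\<close> splits by the parity of \<open>m + l\<close>. In the new coordinates
  \<open>(m + l)/2\<close> and \<open>(m - l)/2\<close> the even part is again \<open>\<int>\<^sup>2\<close> and yields the product of two \<open>\<theta>\<^sub>3\<close>, while the
  odd part is \<open>(\<int> + 1/2)\<^sup>2\<close> and yields the product of two \<open>\<theta>\<^sub>2\<close>; the quadratic form doubles, which
  turns \<open>\<tau>/2\<close> into \<open>\<tau>\<close>.
\<close>
theorem theta3_product_half:
  assumes "Im \<tau> > 0"
  shows "theta3 x (\<tau> / 2) * theta3 y (\<tau> / 2) =
         theta3 (x + y) \<tau> * theta3 (x - y) \<tau> + theta2 (x + y) \<tau> * theta2 (x - y) \<tau>"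
proof -
  define h where "h = (\<lambda>x m. qpow (\<tau> / 2) ((of_int m)\<^sup>2) * exp (of_int (2*m) * \<i> * x))"
  define f where "f = (\<lambda>x m. qpow \<tau> ((of_int m)\<^sup>2) * exp (of_int (2*m) * \<i> * x))"
  define g where "g = (\<lambda>x m. qpow \<tau> ((of_int m + 1/2)\<^sup>2) * exp (of_int (2*m + 1) * \<i> * x))"
  have hs: "(\<lambda>m. norm (h x m)) summable_on UNIV" for x
    unfolding h_def using assms by (intro theta_terms_abs_summable) auto
  have fs: "(\<lambda>m. norm (f x m)) summable_on UNIV" and gs: "(\<lambda>m. norm (g x m)) summable_on UNIV" for x
    unfolding f_def g_def using assms by (intro theta_terms_abs_summable; simp)+
  define F where "F = (\<lambda>(m, l). h x m * h y l)"
  \<comment> \<open>Injective parametrisations of the pairs with even and with odd coordinate sum.\<close>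
  define \<phi> where "\<phi> = (\<lambda>(a, b). (a + b, a - b :: int))"
  define \<psi> where "\<psi> = (\<lambda>(a, b). (a + b + 1, a - b :: int))"
  have inj: "inj \<phi>" "inj \<psi>" by (auto simp: inj_on_def \<phi>_def \<psi>_def)
  have summ: "F summable_on A" for A
    using infsum_times(1)[OF hs hs, of x y] unfolding F_def
    by (rule summable_on_subset_banach) auto
  have range: "p \<in> range \<phi> \<longleftrightarrow> even (fst p + snd p)" "p \<in> range \<psi> \<longleftrightarrow> odd (fst p + snd p)" for p
  proof -
    obtain m l where p: "p = (m, l)" by (cases p)
    show "p \<in> range \<phi> \<longleftrightarrow> even (fst p + snd p)"
    proof
      assume "even (fst p + snd p)"
      hence "p = \<phi> ((m + l) div 2, (m - l) div 2)"
        unfolding p \<phi>_def by (simp, presburger)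
      thus "p \<in> range \<phi>" by blast
    qed (auto simp: \<phi>_def)
    show "p \<in> range \<psi> \<longleftrightarrow> odd (fst p + snd p)"
    proof
      assume "odd (fst p + snd p)"
      hence "p = \<psi> ((m + l - 1) div 2, (m - l - 1) div 2)"
        unfolding p \<psi>_def by (simp, presburger)
      thus "p \<in> range \<psi>" by blast
    qed (auto simp: \<psi>_def)
  qed
  have "theta3 x (\<tau> / 2) * theta3 y (\<tau> / 2) = infsum F UNIV"
    using infsum_times(2)[OF hs hs, of x y] by (simp add: theta3_def h_def F_def)
  also have "UNIV = range \<phi> \<union> range \<psi>" using range by blast
  also have "infsum F \<dots> = infsum F (range \<phi>) + infsum F (range \<psi>)"
    using range by (intro infsum_Un_disjoint summ) blast
  also have "infsum F (range \<phi>) = (\<Sum>\<^sub>\<infinity>(a, b)\<in>UNIV \<times> UNIV. f (x + y) a * f (x - y) b)"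
  proof -
    have "F (\<phi> (a, b)) = f (x + y) a * f (x - y) b" for a b
      unfolding F_def \<phi>_def h_def f_def qpow_def
      by (simp add: exp_add [symmetric] power2_eq_square algebra_simps)
    hence "F \<circ> \<phi> = (\<lambda>(a, b). f (x + y) a * f (x - y) b)" by (simp add: fun_eq_iff)
    thus ?thesis unfolding infsum_reindex[OF inj(1)] by simp
  qed
  also have "\<dots> = theta3 (x + y) \<tau> * theta3 (x - y) \<tau>"
    by (subst infsum_times(2)[OF fs fs, symmetric]) (simp add: theta3_def f_def)
  also have "infsum F (range \<psi>) = (\<Sum>\<^sub>\<infinity>(a, b)\<in>UNIV \<times> UNIV. g (x + y) a * g (x - y) b)"
  proof -
    have "F (\<psi> (a, b)) = g (x + y) a * g (x - y) b" for a b
      unfolding F_def \<psi>_def h_def g_def qpow_def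
      by (simp add: exp_add [symmetric] power2_eq_square algebra_simps add_divide_distrib)
    hence "F \<circ> \<psi> = (\<lambda>(a, b). g (x + y) a * g (x - y) b)" by (simp add: fun_eq_iff)
    thus ?thesis unfolding infsum_reindex[OF inj(2)] by simp
  qed
  also have "\<dots> = theta2 (x + y) \<tau> * theta2 (x - y) \<tau>"
    by (subst infsum_times(2)[OF gs gs, symmetric]) (simp add: theta2_def g_def)
  finally show ?thesis .
qed

text \<open>
  A shift of both arguments by \<open>\<pi>/2\<close> changes the sign of the \<open>\<theta>\<^sub>2\<close> term only, so sum and difference of
  the two products both factor over \<open>\<tau>/2\<close>.
\<close>
lemma theta3_squares:
  assumes "Im \<tau> > 0"
  shows "(theta3 x \<tau>)\<^sup>2 + (theta2 x \<tau>)\<^sup>2 = theta3 x (\<tau> / 2) * theta3 0 (\<tau> / 2)"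
    and "(theta3 x \<tau>)\<^sup>2 - (theta2 x \<tau>)\<^sup>2 =
           theta3 (x + of_real (pi / 2)) (\<tau> / 2) * theta3 (of_real (pi / 2)) (\<tau> / 2)"
    and "theta3 (x + y) \<tau> * theta3 (x - y) \<tau> - theta2 (x + y) \<tau> * theta2 (x - y) \<tau> =
           theta3 (x + of_real (pi / 2)) (\<tau> / 2) * theta3 (y + of_real (pi / 2)) (\<tau> / 2)"
proof -
  show "(theta3 x \<tau>)\<^sup>2 + (theta2 x \<tau>)\<^sup>2 = theta3 x (\<tau> / 2) * theta3 0 (\<tau> / 2)"
    using theta3_product_half[OF assms, of x 0] by (simp add: power2_eq_square)
  show *: "theta3 (x + y) \<tau> * theta3 (x - y) \<tau> - theta2 (x + y) \<tau> * theta2 (x - y) \<tau> =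
           theta3 (x + of_real (pi / 2)) (\<tau> / 2) * theta3 (y + of_real (pi / 2)) (\<tau> / 2)" for y
  proof -
    have "x + of_real (pi / 2) + (y + of_real (pi / 2)) = (x + y) + of_real pi"
         "x + of_real (pi / 2) - (y + of_real (pi / 2)) = x - y" by simp_all
    thus ?thesis unfolding theta3_product_half[OF assms]
      by (simp only: theta3_add_pi theta2_add_pi) simp
  qed
  show "(theta3 x \<tau>)\<^sup>2 - (theta2 x \<tau>)\<^sup>2 =
           theta3 (x + of_real (pi / 2)) (\<tau> / 2) * theta3 (of_real (pi / 2)) (\<tau> / 2)"
    using *[of 0] by (simp add: power2_eq_square)
qed

text \<open>
  Write \<open>T\<close> for \<open>\<theta>\<^sub>3\<close> at \<open>\<tau>/2\<close>, and let \<open>A\<close> and \<open>B\<close> be the two products on the left. Then \<open>A + B\<close> and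
  \<open>A - B\<close> are products of two values of \<open>T\<close>, and so are the sum and difference of the squares at \<open>x\<close>
  and at \<open>c\<close>; after multiplication by \<open>K = T(0) T(\<pi>/2)\<close> the same four values of \<open>T\<close> occur on both sides.
  The formula is parametrised by \<open>c\<close> rather than by the shift \<open>c - \<pi>/2\<close> so that the squares on the
  right are the ones in the \<open>b_i\<close>.
\<close>
theorem theta_addition:
  assumes "Im \<tau> > 0"
  defines "K \<equiv> theta3 0 (\<tau> / 2) * theta3 (of_real (pi / 2)) (\<tau> / 2)"
  shows "K * (theta3 (x + (c - of_real (pi / 2))) \<tau> * theta3 (x - (c - of_real (pi / 2))) \<tau>) =
           (theta3 x \<tau>)\<^sup>2 * (theta3 c \<tau>)\<^sup>2 - (theta2 x \<tau>)\<^sup>2 * (theta2 c \<tau>)\<^sup>2"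
    and "K * (theta2 (x + (c - of_real (pi / 2))) \<tau> * theta2 (x - (c - of_real (pi / 2))) \<tau>) =
           (theta2 x \<tau>)\<^sup>2 * (theta3 c \<tau>)\<^sup>2 - (theta3 x \<tau>)\<^sup>2 * (theta2 c \<tau>)\<^sup>2"
    and "K \<noteq> 0"
proof -
  define y where "y = c - of_real (pi / 2)"
  define T where "T = (\<lambda>x. theta3 x (\<tau> / 2))"
  define h where "h = (of_real (pi / 2) :: complex)"
  note sq = theta3_squares[OF assms(1), folded h_def]
  have "T (c + h) = T (y + of_real pi)" by (simp add: y_def h_def add_ac)
  hence Ty: "T y = T (c + h)" by (simp only: T_def theta3_add_pi)
  have Tyh: "T (y + h) = T c" by (simp add: y_def h_def)
  define A where "A = theta3 (x + y) \<tau> * theta3 (x - y) \<tau>"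
  define B where "B = theta2 (x + y) \<tau> * theta2 (x - y) \<tau>"
  have plus: "A + B = T x * T (c + h)"
    unfolding A_def B_def Ty[symmetric] unfolding T_def using theta3_product_half[OF assms(1), of x y] by simp
  have minus: "A - B = T (x + h) * T c"
    unfolding A_def B_def Tyh[symmetric] unfolding T_def using sq(3)[of x y] by simp
  have K: "K = T 0 * T h" by (simp add: K_def T_def h_def)
  have px: "(theta3 z \<tau>)\<^sup>2 + (theta2 z \<tau>)\<^sup>2 = T z * T 0"
       "(theta3 z \<tau>)\<^sup>2 - (theta2 z \<tau>)\<^sup>2 = T (z + h) * T h" for z
    using sq(1,2)[of z] by (simp_all add: T_def)
  have "K * (A + B) = ((theta3 x \<tau>)\<^sup>2 + (theta2 x \<tau>)\<^sup>2) * ((theta3 c \<tau>)\<^sup>2 - (theta2 c \<tau>)\<^sup>2)"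
    unfolding px plus K by (simp only: mult_ac)
  moreover have "K * (A - B) = ((theta3 x \<tau>)\<^sup>2 - (theta2 x \<tau>)\<^sup>2) * ((theta3 c \<tau>)\<^sup>2 + (theta2 c \<tau>)\<^sup>2)"
    unfolding px minus K by (simp only: mult_ac)
  ultimately have "2 * (K * A) = 2 * ((theta3 x \<tau>)\<^sup>2 * (theta3 c \<tau>)\<^sup>2 - (theta2 x \<tau>)\<^sup>2 * (theta2 c \<tau>)\<^sup>2)"
    "2 * (K * B) = 2 * ((theta2 x \<tau>)\<^sup>2 * (theta3 c \<tau>)\<^sup>2 - (theta3 x \<tau>)\<^sup>2 * (theta2 c \<tau>)\<^sup>2)"
    by algebra+
  thus "K * (theta3 (x + (c - of_real (pi / 2))) \<tau> * theta3 (x - (c - of_real (pi / 2))) \<tau>) =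
           (theta3 x \<tau>)\<^sup>2 * (theta3 c \<tau>)\<^sup>2 - (theta2 x \<tau>)\<^sup>2 * (theta2 c \<tau>)\<^sup>2"
    "K * (theta2 (x + (c - of_real (pi / 2))) \<tau> * theta2 (x - (c - of_real (pi / 2))) \<tau>) =
           (theta2 x \<tau>)\<^sup>2 * (theta3 c \<tau>)\<^sup>2 - (theta3 x \<tau>)\<^sup>2 * (theta2 c \<tau>)\<^sup>2"
    unfolding A_def B_def y_def by (simp_all only: mult_cancel_left) simp_all
  show "K \<noteq> 0"
    using theta3_real_nonzero[of "\<tau> / 2" 0] theta3_real_nonzero[of "\<tau> / 2" "pi / 2"] assms(1)
    by (simp add: K_def)
qed

section \<open>The Chebyshev-Blaschke product as a rational function\<close>

lemma prod_pairing:
  fixes g :: "nat \<Rightarrow> 'a :: comm_monoid_mult"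
  shows "(\<Prod>k=1..n. g k) = (\<Prod>k=1..n div 2. g k * g (n + 1 - k)) * (if odd n then g (n div 2 + 1) else 1)"
proof -
  define d where "d = n div 2"
  define M where "M = (if odd n then {d + 1} else {})"
  have n: "n = 2 * d + (if odd n then 1 else 0)" unfolding d_def by presburger
  have split: "{1..n} = ({1..d} \<union> {n + 1 - d..n}) \<union> M"
    using n by (auto simp: M_def split: if_splits)
  have "(\<Prod>k=1..n. g k) = (\<Prod>k\<in>{1..d} \<union> {n + 1 - d..n}. g k) * (\<Prod>k\<in>M. g k)"
    unfolding split by (rule prod.union_disjoint) (use n in \<open>auto simp: M_def split: if_splits\<close>)
  also have "(\<Prod>k\<in>{1..d} \<union> {n + 1 - d..n}. g k) = (\<Prod>k=1..d. g k) * (\<Prod>k=n + 1 - d..n. g k)"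
    by (rule prod.union_disjoint) (use n in \<open>auto split: if_splits\<close>)
  also have "(\<Prod>k=n + 1 - d..n. g k) = (\<Prod>k=1..d. g (n + 1 - k))"
    by (rule prod.reindex_bij_witness[of _ "\<lambda>k. n + 1 - k" "\<lambda>k. n + 1 - k"])
       (use n in \<open>auto split: if_splits\<close>)
  finally show ?thesis by (simp add: M_def d_def prod.distrib)
qed

text \<open>
  The arguments at which the \<open>b_i\<close> are evaluated; they are the shifts of the multiplication formula
  moved by \<open>\<pi>/2\<close>.
\<close>
definition theta_node :: "nat \<Rightarrow> nat \<Rightarrow> real" where
  "theta_node n i = (2 * real i - 1) * pi / (2 * real n)"

lemma b_coeff_conv_theta_node:
  "b_coeff n i \<tau> = (theta2 (of_real (theta_node n i)) \<tau>)\<^sup>2 / (theta3 (of_real (theta_node n i)) \<tau>)\<^sup>2"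
  by (simp add: b_coeff_def theta_node_def)

text \<open>
  Pair the shift with index \<open>k\<close> with its negative, which has index \<open>n + 1 - k\<close>. By the addition
  formula each pair contributes one Blaschke factor in \<open>z\<^sup>2\<close>, and the constant \<open>K\<close> cancels; for odd \<open>n\<close>
  the unpaired shift is \<open>0\<close> and contributes \<open>z\<close>. Zeros of the denominators are harmless, because the
  equalities hold for the convention \<open>x / 0 = 0\<close> as well.
\<close>
theorem theta_quotient_multiplication:
  assumes n: "n > 0" and \<tau>: "Im \<tau> > 0" and u: "theta3 u \<tau> \<noteq> 0"
  defines "z \<equiv> theta2 u \<tau> / theta3 u \<tau>"
  shows "theta2 (of_nat n * u) (of_nat n * \<tau>) / theta3 (of_nat n * u) (of_nat n * \<tau>) =
         z ^ (n mod 2) * (\<Prod>i=1..n div 2. (z\<^sup>2 - b_coeff n i \<tau>) / (1 - b_coeff n i \<tau> * z\<^sup>2))"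
proof -
  obtain c where c: "c \<noteq> 0"
    "\<And>v. theta3 (of_nat n * v) (of_nat n * \<tau>) = c * (\<Prod>k=1..n. theta3 (v + of_real (theta_shift n k)) \<tau>)"
    "\<And>v. theta2 (of_nat n * v) (of_nat n * \<tau>) = c * (\<Prod>k=1..n. theta2 (v + of_real (theta_shift n k)) \<tau>)"
    using theta_multiplication[OF n \<tau>] by blast
  define g where "g = (\<lambda>k. theta2 (u + of_real (theta_shift n k)) \<tau> / theta3 (u + of_real (theta_shift n k)) \<tau>)"
  have "theta2 (of_nat n * u) (of_nat n * \<tau>) / theta3 (of_nat n * u) (of_nat n * \<tau>) = (\<Prod>k=1..n. g k)"
    using c(1) by (simp add: c(2,3) g_def prod_dividef)
  also have "\<dots> = (\<Prod>k=1..n div 2. g k * g (n + 1 - k)) * (if odd n then g (n div 2 + 1) else 1)"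
    by (rule prod_pairing)
  also have "(if odd n then g (n div 2 + 1) else 1) = z ^ (n mod 2)"
  proof (cases "odd n")
    case True
    then obtain m where m: "n = 2 * m + 1" by (elim oddE)
    have "theta_shift n (n div 2 + 1) = 0"
      by (simp add: theta_shift_def m field_simps)
    thus ?thesis using True by (simp add: g_def z_def odd_iff_mod_2_eq_one)
  qed auto
  also have "(\<Prod>k=1..n div 2. g k * g (n + 1 - k)) =
             (\<Prod>i=1..n div 2. (z\<^sup>2 - b_coeff n i \<tau>) / (1 - b_coeff n i \<tau> * z\<^sup>2))"
  proof (rule prod.cong)
    fix i assume i: "i \<in> {1..n div 2}"
    define x where "x = (of_real (theta_node n i) :: complex)"
    have sh: "theta_shift n (n + 1 - i) = - theta_shift n i"
      using i by (intro theta_shift_reflect) auto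
    have ux: "u + of_real (theta_shift n i) = u + (x - of_real (pi / 2))"
      by (simp add: theta_shift_def theta_node_def x_def)
    have ux': "u + of_real (theta_shift n (n + 1 - i)) = u - (x - of_real (pi / 2))"
      unfolding sh by (simp add: theta_shift_def theta_node_def x_def)
    define S2 S3 C2 C3 where S: "S2 = (theta2 u \<tau>)\<^sup>2" "S3 = (theta3 u \<tau>)\<^sup>2"
       "C2 = (theta2 x \<tau>)\<^sup>2" "C3 = (theta3 x \<tau>)\<^sup>2"
    define K where "K = theta3 0 (\<tau> / 2) * theta3 (of_real (pi / 2)) (\<tau> / 2)"
    note add = theta_addition[OF \<tau>, folded K_def]
    have "g i * g (n + 1 - i) =
          (K * (theta2 (u + (x - of_real (pi / 2))) \<tau> * theta2 (u - (x - of_real (pi / 2))) \<tau>)) /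
          (K * (theta3 (u + (x - of_real (pi / 2))) \<tau> * theta3 (u - (x - of_real (pi / 2))) \<tau>))"
      unfolding g_def ux ux' using add(3) by simp
    also have "\<dots> = (S2 * C3 - S3 * C2) / (S3 * C3 - S2 * C2)"
      unfolding add(1,2) S ..
    also have "\<dots> = ((S3 * C3) * (S2 / S3 - C2 / C3)) / ((S3 * C3) * (1 - C2 / C3 * (S2 / S3)))"
    proof -
      have "C3 \<noteq> 0" "S3 \<noteq> 0"
        using theta3_real_nonzero[OF \<tau>] u by (auto simp: S x_def)
      hence "S2 * C3 - S3 * C2 = (S3 * C3) * (S2 / S3 - C2 / C3)"
         "S3 * C3 - S2 * C2 = (S3 * C3) * (1 - C2 / C3 * (S2 / S3))"
        by (simp_all add: field_simps)
      thus ?thesis by simp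
    qed
    also have "\<dots> = (S2 / S3 - C2 / C3) / (1 - C2 / C3 * (S2 / S3))"
      using theta3_real_nonzero[OF \<tau>] u by (subst mult_divide_mult_cancel_left) (auto simp: S x_def)
    also have "C2 / C3 = b_coeff n i \<tau>"
      by (simp add: S b_coeff_conv_theta_node x_def)
    also have "S2 / S3 = z\<^sup>2"
      by (simp add: S z_def power_divide)
    finally show "g i * g (n + 1 - i) = (z\<^sup>2 - b_coeff n i \<tau>) / (1 - b_coeff n i \<tau> * z\<^sup>2)" .
  qed auto
  finally show ?thesis by (simp add: mult.commute)
qed

text \<open>
  On the imaginary axis \<open>q\<close> is real, so conjugation only replaces \<open>x\<close> by \<open>-x\<close>, and both functions are
  even.
\<close>
lemma theta_of_real_imag_axis:
  assumes "Re \<tau> = 0" "Im \<tau> > 0"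
  shows "theta3 (of_real x) \<tau> \<in> \<real>" "theta2 (of_real x) \<tau> \<in> \<real>"
proof -
  have q: "cnj (qpow \<tau> a) = qpow \<tau> a" for a
  proof -
    have "2 * of_real pi * \<i> * of_real a * \<tau> = of_real (- 2 * pi * a * Im \<tau>)"
      using assms by (simp add: complex_eq_iff)
    hence "qpow \<tau> a = of_real (exp (- 2 * pi * a * Im \<tau>))"
      unfolding qpow_def by (simp only: exp_of_real)
    thus ?thesis by simp
  qed
  have e: "cnj (exp (of_int m * \<i> * of_real x)) = exp (of_int m * \<i> * - of_real x)" for m
    by (simp add: exp_cnj)
  have "cnj (theta3 (of_real x) \<tau>) = theta3 (- of_real x) \<tau>"
    unfolding theta3_def infsum_cnj [symmetric] complex_cnj_mult q e ..
  thus "theta3 (of_real x) \<tau> \<in> \<real>" by (simp add: theta3_minus Reals_cnj_iff)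
  have "cnj (theta2 (of_real x) \<tau>) = theta2 (- of_real x) \<tau>"
    unfolding theta2_def infsum_cnj [symmetric] complex_cnj_mult q e ..
  thus "theta2 (of_real x) \<tau> \<in> \<real>" by (simp add: theta2_minus Reals_cnj_iff)
qed

text \<open>
  A continuous real function without zeros on the real line has constant sign.
\<close>
lemma theta3_imag_axis_same_sign:
  assumes "Re \<tau> = 0" "Im \<tau> > 0"
  shows "Re (theta3 (of_real x) \<tau>) * Re (theta3 (of_real y) \<tau>) > 0"
proof -
  define f where "f = (\<lambda>x. Re (theta3 (of_real x) \<tau>))"
  have nz: "f x \<noteq> 0" for x
    using theta3_real_nonzero[OF assms(2), of x] theta_of_real_imag_axis(1)[OF assms, of x]
    by (auto simp: f_def complex_is_Real_iff complex_eq_iff)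
  have cont: "continuous_on UNIV f"
    unfolding f_def
    by (intro continuous_on_Re continuous_on_compose2[OF holomorphic_on_imp_continuous_on[OF theta3_holomorphic[OF assms(2)]]]
         continuous_intros) auto
  have "connected (range f)"
    using cont by (intro connected_continuous_image) auto
  hence "\<not> (f x < 0 \<and> f y > 0)" for x y
    using nz connectedD_interval[of "range f" "f x" "f y" 0] by fastforce
  hence "f x > 0 \<and> f y > 0 \<or> f x < 0 \<and> f y < 0"
    using nz[of x] nz[of y] by (meson linorder_neqE_linordered_idom)
  thus ?thesis by (auto simp: f_def mult_neg_neg)
qed

text \<open>
  By the addition formulas \<open>\<theta>\<^sub>3\<^sup>2 - \<theta>\<^sub>2\<^sup>2\<close> at a real point is a product of two real values of \<open>\<theta>\<^sub>3\<close> at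
  \<open>\<tau>/2\<close>, which have the same sign.
\<close>
lemma norm_b_coeff_less_1:
  assumes "Re \<tau> = 0" "Im \<tau> > 0"
  shows "norm (b_coeff n i \<tau>) < 1"
proof -
  define x where "x = theta_node n i"
  define a where "a = Re (theta3 (of_real x) \<tau>)"
  define b where "b = Re (theta2 (of_real x) \<tau>)"
  have eq: "theta3 (of_real x) \<tau> = of_real a" "theta2 (of_real x) \<tau> = of_real b"
    using theta_of_real_imag_axis[OF assms] by (auto simp: a_def b_def complex_is_Real_iff complex_eq_iff)
  have half: "Re (\<tau> / 2) = 0" "Im (\<tau> / 2) > 0" using assms by auto
  have "of_real (a\<^sup>2 - b\<^sup>2) = theta3 (of_real (x + pi / 2)) (\<tau> / 2) * theta3 (of_real (pi / 2)) (\<tau> / 2)"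
    using theta3_squares(2)[OF assms(2), of "of_real x"] by (simp add: eq)
  hence "a\<^sup>2 - b\<^sup>2 = Re (theta3 (of_real (x + pi / 2)) (\<tau> / 2) * theta3 (of_real (pi / 2)) (\<tau> / 2))"
    by (metis Re_complex_of_real)
  also have "\<dots> = Re (theta3 (of_real (x + pi / 2)) (\<tau> / 2)) * Re (theta3 (of_real (pi / 2)) (\<tau> / 2))"
    using theta_of_real_imag_axis(1)[OF half, of "x + pi / 2"] by (simp add: complex_is_Real_iff)
  also have "\<dots> > 0" by (rule theta3_imag_axis_same_sign[OF half])
  finally have "b\<^sup>2 < a\<^sup>2" by simp
  moreover have "norm (b_coeff n i \<tau>) = b\<^sup>2 / a\<^sup>2"
    by (simp add: b_coeff_conv_theta_node x_def[symmetric] eq norm_divide norm_power)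
  ultimately show ?thesis by (simp add: divide_less_eq)
qed

text \<open>
  Surjectivity provides a parameter \<open>u\<close> for \<open>z\<close>, and the multiplication formula shows that the value
  is the same for every such \<open>u\<close>.
\<close>
lemma chebyshev_blaschke_eq:
  assumes n: "n > 0" and \<tau>: "Im \<tau> > 0"
  shows "chebyshev_blaschke n \<tau> z =
         z ^ (n mod 2) * (\<Prod>i=1..n div 2. (z\<^sup>2 - b_coeff n i \<tau>) / (1 - b_coeff n i \<tau> * z\<^sup>2))"
proof -
  have quot: "sqrt_k \<sigma> * jacobi_cd (omega1 \<sigma> * w) \<sigma> = theta2 w \<sigma> / theta3 w \<sigma>"
    if "Im \<sigma> > 0" for w \<sigma>
    using theta3_real_nonzero[OF that, of 0] theta2_0_nonzero[OF that]
    by (simp add: sqrt_k_def jacobi_cd_def omega1_def)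
  have n\<tau>: "Im (of_nat n * \<tau>) > 0" using n \<tau> by simp
  have rhs: "sqrt_k (of_nat n * \<tau>) * jacobi_cd (of_nat n * omega1 (of_nat n * \<tau>) * u) (of_nat n * \<tau>) =
             theta2 (of_nat n * u) (of_nat n * \<tau>) / theta3 (of_nat n * u) (of_nat n * \<tau>)" for u
    using quot[OF n\<tau>, of "of_nat n * u"] by (simp add: mult_ac)
  obtain u where u: "theta3 u \<tau> \<noteq> 0" "theta2 u \<tau> / theta3 u \<tau> = z"
    using theta_quotient_surj[OF \<tau>] .
  show ?thesis
    unfolding chebyshev_blaschke_def rhs quot[OF \<tau>]
  proof (rule the_equality)
    show "\<exists>u. theta3 u \<tau> \<noteq> 0 \<and> z = theta2 u \<tau> / theta3 u \<tau> \<and>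
      z ^ (n mod 2) * (\<Prod>i=1..n div 2. (z\<^sup>2 - b_coeff n i \<tau>) / (1 - b_coeff n i \<tau> * z\<^sup>2)) =
      theta2 (of_nat n * u) (of_nat n * \<tau>) / theta3 (of_nat n * u) (of_nat n * \<tau>)"
      using u theta_quotient_multiplication[OF n \<tau> u(1)] by (intro exI[of _ u]) simp
  qed (use theta_quotient_multiplication[OF n \<tau>] in auto)
qed

lemma prod_diff_conv_elem_sym:
  fixes a b :: "'a :: comm_ring_1"
  assumes "finite A"
  shows "(\<Prod>i\<in>A. a - f i * b) =
         (\<Sum>j\<le>card A. (-1) ^ j * (\<Sum>I | I \<subseteq> A \<and> card I = j. \<Prod>i\<in>I. f i) * b ^ j * a ^ (card A - j))"
proof -
  have "(\<Prod>i\<in>A. a - f i * b) = (\<Prod>i\<in>A. - (f i * b) + a)" by simp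
  also have "\<dots> = (\<Sum>I\<in>Pow A. (\<Prod>i\<in>I. - (f i * b)) * (\<Prod>i\<in>A - I. a))"
    by (rule prod_add[OF assms])
  also have "\<dots> = (\<Sum>I\<in>Pow A. (-1) ^ card I * (\<Prod>i\<in>I. f i) * b ^ card I * a ^ (card A - card I))"
  proof (rule sum.cong)
    fix I assume "I \<in> Pow A"
    hence "card (A - I) = card A - card I"
      using assms by (intro card_Diff_subset) (auto intro: finite_subset)
    moreover have "(\<Prod>i\<in>I. - (f i * b)) = (-1) ^ card I * (\<Prod>i\<in>I. f i) * b ^ card I"
      using prod.distrib[of "\<lambda>_. -1" "\<lambda>i. f i * b" I] by (simp add: prod.distrib mult_ac)
    ultimately show "(\<Prod>i\<in>I. - (f i * b)) * (\<Prod>i\<in>A - I. a) =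
        (-1) ^ card I * (\<Prod>i\<in>I. f i) * b ^ card I * a ^ (card A - card I)"
      by simp
  qed auto
  also have "\<dots> = (\<Sum>j\<le>card A. \<Sum>I | I \<in> Pow A \<and> card I = j.
                   (-1) ^ card I * (\<Prod>i\<in>I. f i) * b ^ card I * a ^ (card A - card I))"
    by (rule sum.group [symmetric]) (use assms in \<open>auto intro: card_mono\<close>)
  also have "\<dots> = (\<Sum>j\<le>card A. (-1) ^ j * (\<Sum>I | I \<subseteq> A \<and> card I = j. \<Prod>i\<in>I. f i) * b ^ j * a ^ (card A - j))"
    by (intro sum.cong refl) (simp add: sum_distrib_left sum_distrib_right)
  finally show ?thesis .
qed

lemma S_coeff_0 [simp]: "S_coeff n 0 \<tau> = 1"
proof -
  have "{I. I \<subseteq> {1..n div 2} \<and> card I = 0} = {{}}"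
    by (auto dest: finite_subset)
  thus ?thesis by (simp add: S_coeff_def)
qed

lemma prod_conv_S_coeff:
  "(\<Prod>i=1..n div 2. 1 - b_coeff n i \<tau> * z\<^sup>2) = 1 + (\<Sum>j=1..n div 2. (-1)^j * S_coeff n j \<tau> * z^(2*j))"
  "(\<Prod>i=1..n div 2. z\<^sup>2 - b_coeff n i \<tau>) =
     z^(2*(n div 2)) + (\<Sum>j=1..n div 2. (-1)^j * S_coeff n j \<tau> * z^(2*(n div 2) - 2*j))"
proof -
  define d where "d = n div 2"
  have split: "(\<Sum>j\<le>d. h j) = h 0 + (\<Sum>j=1..d. h j)" for h :: "nat \<Rightarrow> complex"
    by (simp add: atMost_atLeast0 sum.atLeast_Suc_atMost)
  have "(\<Prod>i=1..d. 1 - b_coeff n i \<tau> * z\<^sup>2) =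
        (\<Sum>j\<le>d. (-1) ^ j * S_coeff n j \<tau> * (z\<^sup>2) ^ j * 1 ^ (d - j))"
    by (subst prod_diff_conv_elem_sym) (simp_all add: S_coeff_def d_def)
  thus "(\<Prod>i=1..n div 2. 1 - b_coeff n i \<tau> * z\<^sup>2) = 1 + (\<Sum>j=1..n div 2. (-1)^j * S_coeff n j \<tau> * z^(2*j))"
    unfolding split by (simp add: d_def flip: power_mult)
  have "(\<Prod>i=1..d. z\<^sup>2 - b_coeff n i \<tau> * 1) =
        (\<Sum>j\<le>d. (-1) ^ j * S_coeff n j \<tau> * 1 ^ j * (z\<^sup>2) ^ (d - j))"
    by (subst prod_diff_conv_elem_sym) (simp_all add: S_coeff_def d_def)
  thus "(\<Prod>i=1..n div 2. z\<^sup>2 - b_coeff n i \<tau>) =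
     z^(2*(n div 2)) + (\<Sum>j=1..n div 2. (-1)^j * S_coeff n j \<tau> * z^(2*(n div 2) - 2*j))"
    unfolding split by (simp add: d_def diff_mult_distrib2 flip: power_mult)
qed

theorem chebyshev_blaschke_expansion:
  assumes n: "n > 0" and \<tau>: "\<tau> \<in> pos_imag_axis" and z: "norm z < 1"
  shows "1 + (\<Sum>j=1..n div 2. (-1)^j * S_coeff n j \<tau> * z^(2*j)) \<noteq> 0"
    and "chebyshev_blaschke n \<tau> z =
          z^(n mod 2) *
          ((z^(2*(n div 2)) + (\<Sum>j=1..n div 2. (-1)^j * S_coeff n j \<tau> * z^(2*(n div 2) - 2*j))) /
           (1 + (\<Sum>j=1..n div 2. (-1)^j * S_coeff n j \<tau> * z^(2*j))))"
proof -
  have \<tau>': "Re \<tau> = 0" "Im \<tau> > 0" using \<tau> by (auto simp: pos_imag_axis_def)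
  have "1 - b_coeff n i \<tau> * z\<^sup>2 \<noteq> 0" for i
  proof
    assume "1 - b_coeff n i \<tau> * z\<^sup>2 = 0"
    hence "1 = norm (b_coeff n i \<tau> * z\<^sup>2)" by simp
    also have "\<dots> = norm (b_coeff n i \<tau>) * norm z ^ 2" by (simp add: norm_mult norm_power)
    also have "\<dots> \<le> norm (b_coeff n i \<tau>) * 1"
      using z by (intro mult_left_mono) (auto simp: power_le_one)
    also have "\<dots> < 1" using norm_b_coeff_less_1[OF \<tau>'] by simp
    finally show False by simp
  qed
  thus "1 + (\<Sum>j=1..n div 2. (-1)^j * S_coeff n j \<tau> * z^(2*j)) \<noteq> 0"
    unfolding prod_conv_S_coeff [symmetric] by (simp add: prod_zero_iff)
  show "chebyshev_blaschke n \<tau> z =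
          z^(n mod 2) *
          ((z^(2*(n div 2)) + (\<Sum>j=1..n div 2. (-1)^j * S_coeff n j \<tau> * z^(2*(n div 2) - 2*j))) /
           (1 + (\<Sum>j=1..n div 2. (-1)^j * S_coeff n j \<tau> * z^(2*j))))"
    unfolding prod_conv_S_coeff [symmetric] chebyshev_blaschke_eq[OF n \<tau>'(2)] prod_dividef ..
qed

section \<open>Power series with coefficients in a ring of exponential sums\<close>

text \<open>
  The ring \<open>\<int>[e^(2ix), e^(-2ix)]\<close> of functions of a real variable, generated as an additive group by
  the exponentials. It contains all coefficients of the expansions of the \<open>b_i\<close>, seen as functions of
  the node.
\<close>
inductive_set laurent_ring :: "(real \<Rightarrow> complex) set" where
  exp: "(\<lambda>x. exp (of_int (2 * m) * \<i> * of_real x)) \<in> laurent_ring"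
| uminus: "f \<in> laurent_ring \<Longrightarrow> (\<lambda>x. - f x) \<in> laurent_ring"
| add: "f \<in> laurent_ring \<Longrightarrow> g \<in> laurent_ring \<Longrightarrow> (\<lambda>x. f x + g x) \<in> laurent_ring"

lemma laurent_ring_1: "(\<lambda>x. 1) \<in> laurent_ring"
  using laurent_ring.exp[of 0] by simp

lemma laurent_ring_0: "(\<lambda>x. 0) \<in> laurent_ring"
  using laurent_ring.add[OF laurent_ring_1 laurent_ring.uminus[OF laurent_ring_1]] by simp

lemma laurent_ring_exp_mult:
  assumes "f \<in> laurent_ring"
  shows "(\<lambda>x. exp (of_int (2 * m) * \<i> * of_real x) * f x) \<in> laurent_ring"
  using assms
proof induction
  case (exp l)
  have "exp (of_int (2 * m) * \<i> * of_real x) * exp (of_int (2 * l) * \<i> * of_real x) =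
        exp (of_int (2 * (m + l)) * \<i> * of_real x)" for x
    by (simp add: exp_add [symmetric] algebra_simps)
  thus ?case using laurent_ring.exp[of "m + l"] by simp
qed (auto simp: distrib_left intro: laurent_ring.intros)

lemma laurent_ring_mult:
  assumes "f \<in> laurent_ring" "g \<in> laurent_ring"
  shows "(\<lambda>x. f x * g x) \<in> laurent_ring"
  using assms(1)
proof induction
  case (exp m)
  show ?case by (rule laurent_ring_exp_mult[OF assms(2)])
qed (auto simp: distrib_right intro: laurent_ring.intros)

lemma laurent_ring_sum:
  assumes "\<And>i. i \<in> A \<Longrightarrow> f i \<in> laurent_ring"
  shows "(\<lambda>x. \<Sum>i\<in>A. f i x) \<in> laurent_ring"
  using assms
  by (induction A rule: infinite_finite_induct) (auto intro: laurent_ring_0 laurent_ring.add)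

text \<open>
  The sum is \<open>\<epsilon> \<Sum>w^k\<close> with an \<open>n\<close>-th root of unity \<open>w\<close>. It vanishes unless \<open>w = 1\<close>, and in that case
  \<open>\<epsilon>\<^sup>2 w = 1\<close> forces \<open>\<epsilon> = \<plusminus>1\<close>.
\<close>
lemma sum_exp_theta_node_Ints:
  assumes "n > 0"
  shows "(\<Sum>k=1..n. exp (of_int (2 * m) * \<i> * of_real (theta_node n k))) \<in> \<int>"
proof -
  define \<epsilon> where "\<epsilon> = exp (- (of_int m * \<i> * of_real (pi / n)))"
  define w where "w = exp (of_int (2 * m) * \<i> * of_real (pi / n))"
  have "of_nat n * (of_int (2 * m) * \<i> * of_real (pi / n)) = 2 * of_int m * of_real pi * \<i>"
    using assms by simp
  hence wn: "w ^ n = 1"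
    unfolding w_def exp_of_nat_mult [symmetric] by (simp add: exp_integer_2pi mult_ac)
  have "exp (of_int (2 * m) * \<i> * of_real (theta_node n k)) = \<epsilon> * w ^ k" for k
    unfolding \<epsilon>_def w_def exp_of_nat_mult [symmetric] exp_add [symmetric] using assms
    by (intro arg_cong[where f = exp]) (simp add: theta_node_def field_simps)
  hence eq: "(\<Sum>k=1..n. exp (of_int (2 * m) * \<i> * of_real (theta_node n k))) = \<epsilon> * (\<Sum>k=1..n. w ^ k)"
    by (simp add: sum_distrib_left)
  show ?thesis
  proof (cases "w = 1")
    case True
    have "\<epsilon> * \<epsilon> * w = 1"
      unfolding \<epsilon>_def w_def exp_add [symmetric] by (simp add: algebra_simps)
    hence "\<epsilon> = 1 \<or> \<epsilon> = -1" using True by (simp add: square_eq_1_iff)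
    thus ?thesis unfolding eq using True by auto
  next
    case False
    have "(\<Sum>k=1..n. w ^ k) = w * (\<Sum>k<n. w ^ k)"
      unfolding sum_distrib_left
      by (rule sum.reindex_bij_witness[of _ Suc "\<lambda>k. k - 1"]) (auto simp flip: power_Suc)
    also have "(\<Sum>k<n. w ^ k) = 0"
      using geometric_sum[OF False, of n] wn by simp
    finally show ?thesis unfolding eq by simp
  qed
qed

text \<open>
  Summing over all \<open>n\<close> nodes acts as a trace down to \<open>\<int>\<close>; it takes the place of a Galois argument.
\<close>
lemma laurent_ring_trace:
  assumes "f \<in> laurent_ring" "n > 0"
  shows "(\<Sum>k=1..n. f (theta_node n k)) \<in> \<int>"
  using assms(1)
proof induction
  case (exp m)
  show ?case by (rule sum_exp_theta_node_Ints[OF assms(2)])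
qed (auto simp: sum_negf sum.distrib)

text \<open>
  A family of power series indexed by the node, all of whose coefficients, as functions of the node,
  lie in the ring above: an element of \<open>\<int>[e^(2ix), e^(-2ix)][[X]]\<close>.
\<close>
definition laurent_fps :: "(real \<Rightarrow> complex fps) \<Rightarrow> bool" where
  "laurent_fps F \<longleftrightarrow> (\<forall>N. (\<lambda>x. fps_nth (F x) N) \<in> laurent_ring)"

lemma laurent_fps_mult:
  assumes "laurent_fps F" "laurent_fps G"
  shows "laurent_fps (\<lambda>x. F x * G x)"
  using assms unfolding laurent_fps_def fps_mult_nth
  by (auto intro!: laurent_ring_sum laurent_ring_mult)

lemma laurent_fps_const: "f \<in> laurent_ring \<Longrightarrow> laurent_fps (\<lambda>x. fps_const (f x))"
  unfolding laurent_fps_def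
proof
  fix N assume "f \<in> laurent_ring"
  thus "(\<lambda>x. fps_nth (fps_const (f x)) N) \<in> laurent_ring"
    by (cases "N = 0") (simp_all add: laurent_ring_0)
qed

lemma laurent_fps_power:
  assumes "laurent_fps F"
  shows "laurent_fps (\<lambda>x. F x ^ k)"
proof (induction k)
  case 0
  show ?case using laurent_fps_const[OF laurent_ring_1] by simp
next
  case (Suc k)
  show ?case using laurent_fps_mult[OF assms Suc] by simp
qed

text \<open>
  The constant term \<open>1\<close> keeps the recursion for the coefficients of the inverse free of divisions.
\<close>
lemma laurent_fps_inverse:
  assumes "laurent_fps F" and F0: "\<And>x. fps_nth (F x) 0 = 1"
  shows "laurent_fps (\<lambda>x. inverse (F x))"
  unfolding laurent_fps_def
proof
  fix N show "(\<lambda>x. fps_nth (inverse (F x)) N) \<in> laurent_ring"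
  proof (induction N rule: less_induct)
    case (less N)
    show ?case
    proof (cases N)
      case 0
      thus ?thesis by (simp add: F0 laurent_ring_1)
    next
      case (Suc K)
      have "fps_nth (inverse (F x)) N = - (\<Sum>i=1..N. fps_nth (F x) i * fps_nth (inverse (F x)) (N - i))" for x
        by (simp add: Suc fps_inverse_def F0)
      moreover have "(\<lambda>x. - (\<Sum>i=1..N. fps_nth (F x) i * fps_nth (inverse (F x)) (N - i))) \<in> laurent_ring"
        using assms(1) less unfolding laurent_fps_def
        by (intro laurent_ring.uminus laurent_ring_sum laurent_ring_mult) auto
      ultimately show ?thesis by simp
    qed
  qed
qed

section \<open>Theta functions as power series in the fourth root of q\<close>

lemma fps_of_bilateral_series:
  fixes c :: "int \<Rightarrow> complex" and e :: "int \<Rightarrow> nat"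
  assumes fin: "\<And>N. finite {m. e m = N}"
    and summ: "\<And>X. norm X < 1 \<Longrightarrow> (\<lambda>m. c m * X ^ e m) summable_on UNIV"
  defines "F \<equiv> Abs_fps (\<lambda>N. \<Sum>m | e m = N. c m)"
  shows "fps_conv_radius F \<ge> 1"
    and "norm X < 1 \<Longrightarrow> eval_fps F X = (\<Sum>\<^sub>\<infinity>m. c m * X ^ e m)"
proof -
  have sums: "(\<lambda>N. fps_nth F N * X ^ N) sums (\<Sum>\<^sub>\<infinity>m. c m * X ^ e m)" if X: "norm X < 1" for X
  proof -
    define S where "S = (\<Sum>\<^sub>\<infinity>m. c m * X ^ e m)"
    have "((\<lambda>m. c m * X ^ e m) has_sum S) UNIV"
      unfolding S_def using summ[OF X] by (rule has_sum_infsum)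
    hence "((\<lambda>(N, m). c m * X ^ e m) has_sum S) (Sigma UNIV (\<lambda>N. {m. e m = N}))"
      by (subst has_sum_reindex_bij_witness[of _ "\<lambda>m. (e m, m)" snd UNIV "\<lambda>m. c m * X ^ e m" _ S S])
         auto
    hence "((\<lambda>N. fps_nth F N * X ^ N) has_sum S) UNIV"
    proof (rule has_sum_Sigma')
      fix N
      have "((\<lambda>m. c m * X ^ e m) has_sum (\<Sum>m | e m = N. c m * X ^ e m)) {m. e m = N}"
        by (rule has_sum_finite[OF fin])
      thus "((\<lambda>m. case (N, m) of (N, m) \<Rightarrow> c m * X ^ e m) has_sum fps_nth F N * X ^ N) {m. e m = N}"
        by (simp add: F_def sum_distrib_right)
    qed
    thus ?thesis unfolding S_def by (rule has_sum_imp_sums)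
  qed
  show "fps_conv_radius F \<ge> 1"
    unfolding fps_conv_radius_def
    by (rule conv_radius_geI_ex') (use sums in \<open>auto simp: one_ereal_def sums_iff\<close>)
  show "norm X < 1 \<Longrightarrow> eval_fps F X = (\<Sum>\<^sub>\<infinity>m. c m * X ^ e m)"
    using sums by (simp add: eval_fps_def sums_iff)
qed

text \<open>
  In terms of \<open>X = q^(1/4)\<close> the exponents of \<open>\<theta>\<^sub>3\<close> and \<open>\<theta>\<^sub>2\<close> are the squares of the even and of the odd
  numbers.
\<close>
definition theta3_fps :: "real \<Rightarrow> complex fps" where
  "theta3_fps x = Abs_fps (\<lambda>N. \<Sum>m | nat (4 * m\<^sup>2) = N. exp (of_int (2 * m) * \<i> * of_real x))"

text \<open>
  The factor \<open>e^(ix)\<close> of \<open>\<theta>\<^sub>2\<close> is split off here, because it does not belong to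
  \<open>\<int>[e^(2ix), e^(-2ix)]\<close>; its square does.
\<close>
definition theta2_fps :: "real \<Rightarrow> complex fps" where
  "theta2_fps x = Abs_fps (\<lambda>N. \<Sum>m | nat ((2 * m + 1)\<^sup>2) = N. exp (of_int (2 * m) * \<i> * of_real x))"

lemma laurent_fps_theta: "laurent_fps theta3_fps" "laurent_fps theta2_fps"
  unfolding laurent_fps_def theta3_fps_def theta2_fps_def fps_nth_Abs_fps
  by (intro allI laurent_ring_sum laurent_ring.exp)+

lemma abs_le_square: "\<bar>m\<bar> \<le> (m :: int)\<^sup>2"
  using self_le_power[of "\<bar>m\<bar>" 2] by (cases "m = 0") auto

lemma finite_square_fibres:
  "finite {m :: int. nat (4 * m\<^sup>2) = N}" "finite {m :: int. nat ((2 * m + 1)\<^sup>2) = N}"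
proof -
  have "{m :: int. nat (4 * m\<^sup>2) = N} \<subseteq> {- int N..int N}"
  proof
    fix m :: int assume "m \<in> {m. nat (4 * m\<^sup>2) = N}"
    hence "4 * m\<^sup>2 \<le> int N" by auto
    thus "m \<in> {- int N..int N}" using abs_le_square[of m] by auto
  qed
  thus "finite {m :: int. nat (4 * m\<^sup>2) = N}" by (rule finite_subset) auto
  have "{m :: int. nat ((2 * m + 1)\<^sup>2) = N} \<subseteq> {- int N - 1..int N}"
  proof
    fix m :: int assume "m \<in> {m. nat ((2 * m + 1)\<^sup>2) = N}"
    hence "(2 * m + 1)\<^sup>2 \<le> int N" by auto
    thus "m \<in> {- int N - 1..int N}" using abs_le_square[of "2 * m + 1"] by auto
  qed
  thus "finite {m :: int. nat ((2 * m + 1)\<^sup>2) = N}" by (rule finite_subset) auto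
qed

lemma theta_fps_terms_summable:
  assumes "norm X < 1"
  shows "(\<lambda>m. exp (of_int (2 * m) * \<i> * of_real x) * X ^ nat (4 * m\<^sup>2)) summable_on UNIV"
    and "(\<lambda>m. exp (of_int (2 * m) * \<i> * of_real x) * X ^ nat ((2 * m + 1)\<^sup>2)) summable_on UNIV"
proof -
  have X4: "norm (X ^ 4) < 1" using assms by (simp add: norm_power power_less_one_iff)
  have "exp (of_int (2 * m) * \<i> * of_real x) * X ^ nat (4 * m\<^sup>2) = jterm (X ^ 4) (exp (2 * \<i> * of_real x)) m" for m
    unfolding jterm_def exp_powi_2i by (simp add: nat_mult_distrib power_mult)
  thus "(\<lambda>m. exp (of_int (2 * m) * \<i> * of_real x) * X ^ nat (4 * m\<^sup>2)) summable_on UNIV"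
    using jterm_summable[OF X4] by simp
  show "(\<lambda>m. exp (of_int (2 * m) * \<i> * of_real x) * X ^ nat ((2 * m + 1)\<^sup>2)) summable_on UNIV"
  proof (cases "X = 0")
    case True
    have "nat ((2 * m + 1)\<^sup>2) \<noteq> 0" for m :: int
    proof -
      have "2 * m + 1 \<noteq> 0" by presburger
      thus ?thesis by simp
    qed
    thus ?thesis using True by (simp add: power_0_left)
  next
    case False
    have "exp (of_int (2 * m) * \<i> * of_real x) * X ^ nat ((2 * m + 1)\<^sup>2) =
          X * jterm (X ^ 4) (X ^ 4 * exp (2 * \<i> * of_real x)) m" for m
    proof -
      have "(2 * m + 1)\<^sup>2 = 1 + 4 * m\<^sup>2 + 4 * m"
        by (simp add: power2_eq_square algebra_simps)
      hence "X ^ nat ((2 * m + 1)\<^sup>2) = X powi (1 + 4 * m\<^sup>2 + 4 * m)"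
        unfolding power_int_def by (metis zero_le_power2)
      also have "X powi (1 + 4 * m\<^sup>2 + 4 * m) = X * X powi (4 * m\<^sup>2) * X powi (4 * m)"
        using False by (simp add: power_int_add)
      also have "X powi (4 * m\<^sup>2) = (X ^ 4) ^ nat (m\<^sup>2)"
        by (simp add: power_int_def nat_mult_distrib power_mult)
      also have "X powi (4 * m) = (X ^ 4) powi m"
        by (simp add: power_int_mult)
      finally have eq: "X ^ nat ((2 * m + 1)\<^sup>2) = X * (X ^ 4) ^ nat (m\<^sup>2) * (X ^ 4) powi m" .
      show ?thesis
        unfolding jterm_def power_int_mult_distrib exp_powi_2i eq by (simp only: mult_ac)
    qed
    thus ?thesis using jterm_summable[OF X4] by (simp add: summable_on_cmult_right)
  qed
qed

lemma fps_conv_radius_theta: "fps_conv_radius (theta3_fps x) \<ge> 1" "fps_conv_radius (theta2_fps x) \<ge> 1"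
  unfolding theta3_fps_def theta2_fps_def
  by (rule fps_of_bilateral_series(1)[OF finite_square_fibres(1) theta_fps_terms_summable(1)]
           fps_of_bilateral_series(1)[OF finite_square_fibres(2) theta_fps_terms_summable(2)]; assumption)+

lemma eval_theta_fps:
  assumes "Im \<tau> > 0"
  shows "eval_fps (theta3_fps x) (qpow \<tau> (1/4)) = theta3 (of_real x) \<tau>"
    and "exp (\<i> * of_real x) * eval_fps (theta2_fps x) (qpow \<tau> (1/4)) = theta2 (of_real x) \<tau>"
proof -
  define X where "X = qpow \<tau> (1/4)"
  have X: "norm X < 1" unfolding X_def using norm_qpow_less_1[OF assms] by simp
  have "X ^ nat (4 * m\<^sup>2) = qpow \<tau> ((of_int m)\<^sup>2)" for m :: int
    by (simp add: X_def qpow_power)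
  moreover have "eval_fps (theta3_fps x) X = (\<Sum>\<^sub>\<infinity>m. exp (of_int (2 * m) * \<i> * of_real x) * X ^ nat (4 * m\<^sup>2))"
    unfolding theta3_fps_def
    by (rule fps_of_bilateral_series(2)[OF finite_square_fibres(1) theta_fps_terms_summable(1) X])
  ultimately show "eval_fps (theta3_fps x) X = theta3 (of_real x) \<tau>"
    unfolding theta3_def by (simp only: mult.commute)
  have "exp (\<i> * of_real x) * (exp (of_int (2 * m) * \<i> * of_real x) * X ^ nat ((2 * m + 1)\<^sup>2)) =
        qpow \<tau> ((of_int m + 1/2)\<^sup>2) * exp (of_int (2 * m + 1) * \<i> * of_real x)" for m :: int
  proof -
    have "X ^ nat ((2 * m + 1)\<^sup>2) = qpow \<tau> ((of_int m + 1/2)\<^sup>2)"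
    proof -
      have "real (nat ((2 * m + 1)\<^sup>2)) = (2 * of_int m + 1)\<^sup>2" by simp
      also have "\<dots> = 4 * (of_int m + 1/2)\<^sup>2" by (simp add: power2_eq_square field_simps)
      finally show ?thesis unfolding X_def qpow_power by simp
    qed
    moreover have "exp (of_int (2 * m + 1) * \<i> * of_real x) = exp (\<i> * of_real x) * exp (of_int (2 * m) * \<i> * of_real x)"
      by (simp add: exp_add [symmetric] algebra_simps)
    ultimately show ?thesis by (simp add: mult_ac)
  qed
  moreover have "eval_fps (theta2_fps x) X = (\<Sum>\<^sub>\<infinity>m. exp (of_int (2 * m) * \<i> * of_real x) * X ^ nat ((2 * m + 1)\<^sup>2))"
    unfolding theta2_fps_def
    by (rule fps_of_bilateral_series(2)[OF finite_square_fibres(2) theta_fps_terms_summable(2) X])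
  ultimately show "exp (\<i> * of_real x) * eval_fps (theta2_fps x) X = theta2 (of_real x) \<tau>"
    unfolding theta2_def by (simp only: infsum_cmult_right' [symmetric])
qed

lemma theta3_fps_nth_0: "fps_nth (theta3_fps x) 0 = 1"
proof -
  have "{m :: int. nat (4 * m\<^sup>2) = 0} = {0}" by auto
  thus ?thesis by (simp add: theta3_fps_def)
qed

lemma punctured_disc_qpow_surj:
  assumes "norm X < 1" "X \<noteq> 0"
  obtains \<tau> where "Im \<tau> > 0" "qpow \<tau> (1/4) = X"
proof
  define \<tau> where "\<tau> = 2 * Ln X / (of_real pi * \<i>)"
  show "qpow \<tau> (1/4) = X"
    using assms by (simp add: qpow_def \<tau>_def)
  hence "norm (qpow \<tau> (1/4)) < 1" using assms by simp
  thus "Im \<tau> > 0" by (simp add: norm_qpow zero_less_mult_iff)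
qed

text \<open>
  Every point of the punctured unit disc is a value of \<open>q^(1/4)\<close>, and \<open>\<theta>\<^sub>3\<close> has no real zeros.
\<close>
lemma eval_theta3_fps_nonzero:
  assumes "norm X < 1"
  shows "eval_fps (theta3_fps x) X \<noteq> 0"
proof (cases "X = 0")
  case True
  thus ?thesis by (simp add: eval_fps_at_0 theta3_fps_nth_0)
next
  case False
  then obtain \<tau> where "Im \<tau> > 0" "qpow \<tau> (1/4) = X"
    using punctured_disc_qpow_surj[OF assms] by blast
  thus ?thesis using eval_theta_fps(1)[of \<tau> x] theta3_real_nonzero[of \<tau> x] by simp
qed

definition theta_quotient_fps :: "real \<Rightarrow> complex fps" where
  "theta_quotient_fps x =
     fps_const (exp (of_int (2 * 1) * \<i> * of_real x)) * theta2_fps x ^ 2 * inverse (theta3_fps x) ^ 2"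

lemma laurent_fps_theta_quotient: "laurent_fps theta_quotient_fps"
  unfolding theta_quotient_fps_def
  by (intro laurent_fps_mult laurent_fps_power laurent_fps_const laurent_fps_inverse
        laurent_fps_theta laurent_ring.exp theta3_fps_nth_0)

text \<open>
  The quotient of the two theta series is holomorphic on the whole unit disc because the denominator
  has no zeros there. Hence its formal expansion converges on the unit disc as well.
\<close>
lemma eval_theta_quotient_fps:
  shows "fps_conv_radius (theta_quotient_fps x) \<ge> 1"
    and "Im \<tau> > 0 \<Longrightarrow> eval_fps (theta_quotient_fps x) (qpow \<tau> (1/4)) =
           (theta2 (of_real x) \<tau>)\<^sup>2 / (theta3 (of_real x) \<tau>)\<^sup>2"
proof -
  define f where "f = (\<lambda>X. exp (of_int (2 * 1) * \<i> * of_real x) * eval_fps (theta2_fps x) X ^ 2 *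
                           inverse (eval_fps (theta3_fps x) X) ^ 2)"
  have sub: "X \<in> eball 0 (fps_conv_radius (theta3_fps x))" "X \<in> eball 0 (fps_conv_radius (theta2_fps x))"
    if "norm X < 1" for X
  proof -
    have "ereal (norm X) < 1" using that by (simp add: one_ereal_def)
    thus "X \<in> eball 0 (fps_conv_radius (theta3_fps x))" "X \<in> eball 0 (fps_conv_radius (theta2_fps x))"
      unfolding in_eball_iff dist_0_norm using fps_conv_radius_theta[of x] less_le_trans by blast+
  qed
  have holo: "f holomorphic_on eball 0 1"
    unfolding f_def using eval_theta3_fps_nonzero sub
    by (intro holomorphic_intros holomorphic_on_eval_fps) (auto simp: one_ereal_def)
  have "f has_fps_expansion theta_quotient_fps x"
    unfolding f_def theta_quotient_fps_def
    using fps_conv_radius_theta[of x]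
    by (intro fps_expansion_intros eval_fps_has_fps_expansion)
       (auto simp: theta3_fps_nth_0 intro: less_le_trans[of 0 "1 :: ereal"])
  moreover have "f has_fps_expansion fps_expansion f 0"
    using holo by (intro has_fps_expansion_fps_expansion[of "eball 0 1"]) (auto simp: one_ereal_def)
  ultimately have eq: "fps_expansion f 0 = theta_quotient_fps x"
    using fps_expansion_unique_complex by blast
  show "fps_conv_radius (theta_quotient_fps x) \<ge> 1"
    using conv_radius_fps_expansion[OF holo] by (simp add: eq)
  assume \<tau>: "Im \<tau> > 0"
  define X where "X = qpow \<tau> (1/4)"
  have X: "norm X < 1" unfolding X_def using norm_qpow_less_1[OF \<tau>] by simp
  have "eval_fps (theta_quotient_fps x) X = f X"
    using eval_fps_expansion'[OF holo, of X] X by (simp add: eq one_ereal_def)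
  also have "\<dots> = (exp (\<i> * of_real x) * eval_fps (theta2_fps x) X)\<^sup>2 / (eval_fps (theta3_fps x) X)\<^sup>2"
  proof -
    have "exp (of_int (2 * 1) * \<i> * of_real x) = exp (\<i> * of_real x) ^ 2"
      by (simp add: exp_double [symmetric] mult_ac)
    thus ?thesis by (simp add: f_def power_mult_distrib divide_inverse power_inverse)
  qed
  finally show "eval_fps (theta_quotient_fps x) (qpow \<tau> (1/4)) =
           (theta2 (of_real x) \<tau>)\<^sup>2 / (theta3 (of_real x) \<tau>)\<^sup>2"
    unfolding X_def eval_theta_fps[OF \<tau>] .
qed

section \<open>Integral power series up to a denominator\<close>

lemma fps_int_to_complex_nth [simp]: "fps_nth (fps_int_to_complex P) k = of_int (fps_nth P k)"
  by (simp add: fps_int_to_complex_def)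

lemma fps_int_to_complex_add: "fps_int_to_complex (P + Q) = fps_int_to_complex P + fps_int_to_complex Q"
  by (simp add: fps_eq_iff)

lemma fps_int_to_complex_mult: "fps_int_to_complex (P * Q) = fps_int_to_complex P * fps_int_to_complex Q"
  by (simp add: fps_eq_iff fps_mult_nth)

lemma fps_int_to_complex_const: "fps_int_to_complex (fps_const c) = fps_const (of_int c)"
  by (simp add: fps_eq_iff)

definition q4_integral :: "(complex \<Rightarrow> complex) \<Rightarrow> int fps \<Rightarrow> bool" where
  "q4_integral g P \<longleftrightarrow> fps_conv_radius (fps_int_to_complex P) \<ge> 1 \<and>
     (\<forall>\<tau>\<in>upper_half_plane. g \<tau> = eval_fps (fps_int_to_complex P) (qpow \<tau> (1/4)))"

text \<open>
  The functions that become integral power series in \<open>q^(1/4)\<close>, convergent for all \<open>\<tau>\<close>, after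
  multiplication by a positive integer. They form a \<open>\<rat>\<close>-algebra, and it is the division by integers
  that makes Newton's identities usable.
\<close>
definition q4_rational :: "(complex \<Rightarrow> complex) \<Rightarrow> bool" where
  "q4_rational g \<longleftrightarrow> (\<exists>M>0. \<exists>P. q4_integral (\<lambda>\<tau>. of_nat M * g \<tau>) P)"

lemma norm_q4_less_radius:
  assumes "q4_integral g P" "\<tau> \<in> upper_half_plane"
  shows "ereal (norm (qpow \<tau> (1/4))) < fps_conv_radius (fps_int_to_complex P)"
proof -
  have "ereal (norm (qpow \<tau> (1/4))) < 1"
    using norm_qpow_less_1[of \<tau> "1/4"] assms(2) by (simp add: upper_half_plane_def)
  thus ?thesis using assms(1) less_le_trans unfolding q4_integral_def by blast
qed

lemma q4_integral_const: "q4_integral (\<lambda>_. of_int c) (fps_const c)"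
  by (simp add: q4_integral_def fps_int_to_complex_const)

lemma q4_integral_add:
  assumes f: "q4_integral f P" and g: "q4_integral g Q"
  shows "q4_integral (\<lambda>\<tau>. f \<tau> + g \<tau>) (P + Q)"
  unfolding q4_integral_def fps_int_to_complex_add
proof (intro conjI ballI)
  show "1 \<le> fps_conv_radius (fps_int_to_complex P + fps_int_to_complex Q)"
    using f g unfolding q4_integral_def by (intro order_trans[OF _ fps_conv_radius_add]) auto
  fix \<tau> assume \<tau>: "\<tau> \<in> upper_half_plane"
  show "f \<tau> + g \<tau> = eval_fps (fps_int_to_complex P + fps_int_to_complex Q) (qpow \<tau> (1/4))"
    using eval_fps_add[OF norm_q4_less_radius[OF f \<tau>] norm_q4_less_radius[OF g \<tau>]] f g \<tau>
    by (simp add: q4_integral_def)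
qed

lemma q4_integral_mult:
  assumes f: "q4_integral f P" and g: "q4_integral g Q"
  shows "q4_integral (\<lambda>\<tau>. f \<tau> * g \<tau>) (P * Q)"
  unfolding q4_integral_def fps_int_to_complex_mult
proof (intro conjI ballI)
  show "1 \<le> fps_conv_radius (fps_int_to_complex P * fps_int_to_complex Q)"
    using f g unfolding q4_integral_def by (intro order_trans[OF _ fps_conv_radius_mult]) auto
  fix \<tau> assume \<tau>: "\<tau> \<in> upper_half_plane"
  show "f \<tau> * g \<tau> = eval_fps (fps_int_to_complex P * fps_int_to_complex Q) (qpow \<tau> (1/4))"
    using eval_fps_mult[OF norm_q4_less_radius[OF f \<tau>] norm_q4_less_radius[OF g \<tau>]] f g \<tau>
    by (simp add: q4_integral_def)
qed

lemma q4_rational_const: "q4_rational (\<lambda>_. of_int c)"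
  unfolding q4_rational_def using q4_integral_const[of c] by (intro exI[of _ 1]) auto

lemma q4_rational_add:
  assumes "q4_rational f" "q4_rational g"
  shows "q4_rational (\<lambda>\<tau>. f \<tau> + g \<tau>)"
proof -
  obtain M P where P: "M > 0" "q4_integral (\<lambda>\<tau>. of_nat M * f \<tau>) P"
    using assms(1) unfolding q4_rational_def by blast
  obtain N Q where Q: "N > 0" "q4_integral (\<lambda>\<tau>. of_nat N * g \<tau>) Q"
    using assms(2) unfolding q4_rational_def by blast
  have "q4_integral (\<lambda>\<tau>. of_int (int N) * (of_nat M * f \<tau>) + of_int (int M) * (of_nat N * g \<tau>))
          (fps_const (int N) * P + fps_const (int M) * Q)"
    by (intro q4_integral_add q4_integral_mult q4_integral_const P Q)
  moreover have "(\<lambda>\<tau>. of_int (int N) * (of_nat M * f \<tau>) + of_int (int M) * (of_nat N * g \<tau>)) =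
      (\<lambda>\<tau>. of_nat (M * N) * (f \<tau> + g \<tau>))"
    by (simp add: fun_eq_iff algebra_simps)
  ultimately show ?thesis using P(1) Q(1) unfolding q4_rational_def by (metis nat_0_less_mult_iff)
qed

lemma q4_rational_mult:
  assumes "q4_rational f" "q4_rational g"
  shows "q4_rational (\<lambda>\<tau>. f \<tau> * g \<tau>)"
proof -
  obtain M P where P: "M > 0" "q4_integral (\<lambda>\<tau>. of_nat M * f \<tau>) P"
    using assms(1) unfolding q4_rational_def by blast
  obtain N Q where Q: "N > 0" "q4_integral (\<lambda>\<tau>. of_nat N * g \<tau>) Q"
    using assms(2) unfolding q4_rational_def by blast
  have "q4_integral (\<lambda>\<tau>. (of_nat M * f \<tau>) * (of_nat N * g \<tau>)) (P * Q)"
    by (intro q4_integral_mult P Q)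
  moreover have "(\<lambda>\<tau>. (of_nat M * f \<tau>) * (of_nat N * g \<tau>)) = (\<lambda>\<tau>. of_nat (M * N) * (f \<tau> * g \<tau>))"
    by (simp add: fun_eq_iff algebra_simps)
  ultimately show ?thesis using P(1) Q(1) unfolding q4_rational_def by (metis nat_0_less_mult_iff)
qed

lemma q4_rational_sum:
  assumes "\<And>i. i \<in> A \<Longrightarrow> q4_rational (f i)"
  shows "q4_rational (\<lambda>\<tau>. \<Sum>i\<in>A. f i \<tau>)"
  using assms
proof (induction A rule: infinite_finite_induct)
  case (insert i A)
  thus ?case by (simp add: q4_rational_add)
qed (use q4_rational_const[of 0] in simp_all)

lemma q4_rational_of_nat_multD:
  assumes "q4_rational (\<lambda>\<tau>. of_nat m * f \<tau>)" "m > 0"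
  shows "q4_rational f"
proof -
  obtain M P where P: "M > 0" "q4_integral (\<lambda>\<tau>. of_nat M * (of_nat m * f \<tau>)) P"
    using assms(1) unfolding q4_rational_def by blast
  have "(\<lambda>\<tau>. of_nat M * (of_nat m * f \<tau>)) = (\<lambda>\<tau>. of_nat (M * m) * f \<tau>)"
    by (simp add: fun_eq_iff)
  thus ?thesis using P assms(2) unfolding q4_rational_def by (metis nat_0_less_mult_iff)
qed

lemma q4_rational_has_expansion:
  assumes "q4_rational g"
  shows "\<exists>F\<in>Frac_int_fps. has_q4_expansion g F"
proof -
  obtain M P where M: "M > 0" and P: "q4_integral (\<lambda>\<tau>. of_nat M * g \<tau>) P"
    using assms unfolding q4_rational_def by blast
  define G where "G = (\<lambda>X. eval_fps (fps_int_to_complex P) X / of_nat M)"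
  define F where "F = fps_to_fls (fps_int_to_complex P) / fps_to_fls (fps_int_to_complex (fps_const (int M)))"
  have radius: "fps_conv_radius (fps_int_to_complex P) > 0"
    using P less_le_trans[of 0 "1 :: ereal"] by (auto simp: q4_integral_def)
  have "eval_fps (fps_int_to_complex P) has_laurent_expansion fps_to_fls (fps_int_to_complex P)"
    by (intro has_laurent_expansion_fps eval_fps_has_fps_expansion radius)
  moreover have "(\<lambda>_. of_nat M) has_laurent_expansion fps_to_fls (fps_int_to_complex (fps_const (int M)))"
    unfolding fps_int_to_complex_const by (intro has_laurent_expansion_fps) simp
  ultimately have "G has_laurent_expansion F"
    unfolding G_def F_def by (rule has_laurent_expansion_divide)
  moreover have eq: "g \<tau> = G (qpow \<tau> (1/4))" if "\<tau> \<in> upper_half_plane" for \<tau>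
    using P that M by (simp add: q4_integral_def G_def field_simps)
  moreover have "g meromorphic_on upper_half_plane"
  proof -
    have op: "open upper_half_plane"
      unfolding upper_half_plane_def by (rule open_halfspace_Im_gt)
    have "eval_fps (fps_int_to_complex P) \<circ> (\<lambda>\<tau>. qpow \<tau> (1/4)) holomorphic_on upper_half_plane"
    proof (rule holomorphic_on_compose_gen[OF _ holomorphic_on_eval_fps[OF order_refl]])
      show "(\<lambda>\<tau>. qpow \<tau> (1/4)) holomorphic_on upper_half_plane"
        unfolding qpow_def by (intro holomorphic_intros)
      show "(\<lambda>\<tau>. qpow \<tau> (1/4)) ` upper_half_plane \<subseteq> eball 0 (fps_conv_radius (fps_int_to_complex P))"
        using norm_q4_less_radius[OF P] by auto
    qed
    hence "(\<lambda>\<tau>. G (qpow \<tau> (1/4))) holomorphic_on upper_half_plane"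
      unfolding G_def o_def using M by (intro holomorphic_intros) auto
    hence "g holomorphic_on upper_half_plane"
      using eq by (subst holomorphic_cong[OF refl, of _ _ "\<lambda>\<tau>. G (qpow \<tau> (1/4))"]) auto
    thus ?thesis using op by (intro analytic_on_imp_meromorphic_on) (simp add: analytic_on_open)
  qed
  ultimately have "has_q4_expansion g F"
    unfolding has_q4_expansion_def by blast
  moreover have "F \<in> Frac_int_fps"
    unfolding Frac_int_fps_def F_def using M
    by (intro CollectI exI[of _ P] exI[of _ "fps_const (int M)"] conjI refl) simp
  ultimately show ?thesis by blast
qed

section \<open>Newton identities\<close>

text \<open>
  The logarithmic derivative of \<open>E = \<Prod>(1 - f\<^sub>i X)\<close> is \<open>-\<Sum> f\<^sub>i / (1 - f\<^sub>i X)\<close>, whose coefficients are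
  the power sums.
\<close>
lemma newton_fps:
  fixes f :: "'a \<Rightarrow> complex"
  assumes "finite A"
  defines "E \<equiv> \<lambda>A. \<Prod>i\<in>A. 1 - fps_const (f i) * fps_X"
    and "P \<equiv> \<lambda>A. Abs_fps (\<lambda>k. \<Sum>i\<in>A. f i ^ Suc k)"
  shows "fps_deriv (E A) = - (E A * P A)"
  using assms(1)
proof induction
  case empty
  show ?case by (simp add: E_def P_def fps_eq_iff)
next
  case (insert i A)
  define L where "L = 1 - fps_const (f i) * fps_X"
  define G where "G = Abs_fps (\<lambda>k. f i ^ Suc k)"
  have LG: "L * G = fps_const (f i)"
  proof (rule fps_ext)
    fix k show "fps_nth (L * G) k = fps_nth (fps_const (f i)) k"
      by (cases k) (simp_all add: L_def G_def algebra_simps mult.assoc)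
  qed
  have "P (insert i A) = G + P A"
    using insert by (simp add: P_def G_def fps_eq_iff)
  moreover have "E (insert i A) = L * E A"
    using insert by (simp add: E_def L_def)
  moreover have "fps_deriv L = - fps_const (f i)"
    by (simp add: L_def)
  ultimately show ?case using insert.IH
    by (simp add: algebra_simps flip: LG)
qed

lemma newton_identity:
  fixes f :: "'a \<Rightarrow> complex"
  assumes A: "finite A"
  defines "e \<equiv> \<lambda>j. \<Sum>I | I \<subseteq> A \<and> card I = j. \<Prod>i\<in>I. f i"
    and "p \<equiv> \<lambda>k. \<Sum>i\<in>A. f i ^ k"
  shows "of_nat (Suc j) * e (Suc j) = (\<Sum>k\<le>j. (-1) ^ k * e (j - k) * p (Suc k))"
proof -
  define E where "E = (\<Prod>i\<in>A. 1 - fps_const (f i) * fps_X)"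
  have const_prod: "(\<Prod>i\<in>I. fps_const (f i)) = fps_const (\<Prod>i\<in>I. f i)" for I
    by (induction I rule: infinite_finite_induct) auto
  have const_sum: "(\<Sum>I\<in>B. fps_const (g I)) = fps_const (\<Sum>I\<in>B. g I)" for B and g :: "'a set \<Rightarrow> complex"
    by (induction B rule: infinite_finite_induct) auto
  have E: "fps_nth E j = (-1) ^ j * e j" for j
  proof -
    have "E = (\<Sum>j\<le>card A. (-1) ^ j * fps_const (e j) * fps_X ^ j)"
      unfolding E_def prod_diff_conv_elem_sym[OF A] const_prod const_sum e_def by simp
    also have "\<dots> = (\<Sum>j\<le>card A. fps_const ((-1) ^ j * e j) * fps_X ^ j)"
    proof (rule sum.cong)
      fix j
      have "(-1 :: complex fps) ^ j = fps_const ((-1) ^ j)"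
        by (induction j) (auto simp: fps_eq_iff)
      thus "(-1) ^ j * fps_const (e j) * fps_X ^ j = fps_const ((-1) ^ j * e j) * fps_X ^ j" by simp
    qed auto
    finally have "fps_nth E j = (\<Sum>i\<le>card A. if i = j then (-1) ^ j * e j else 0)"
      by (simp add: fps_sum_nth if_distrib cong: if_cong)
    also have "\<dots> = (-1) ^ j * e j"
    proof (cases "j \<le> card A")
      case False
      hence empty: "{I. I \<subseteq> A \<and> card I = j} = {}" using card_mono[OF A] by auto
      show ?thesis using False unfolding e_def empty by simp
    qed simp
    finally show ?thesis .
  qed
  have "fps_nth (fps_deriv E) j = - (\<Sum>k\<le>j. fps_nth E (j - k) * p (Suc k))"
  proof -
    have "fps_nth (fps_deriv E) j = - fps_nth (Abs_fps (\<lambda>k. p (Suc k)) * E) j"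
      unfolding E_def newton_fps[OF A] p_def by (simp add: mult.commute)
    thus ?thesis unfolding fps_mult_nth by (simp add: atLeast0AtMost mult.commute)
  qed
  hence "(-1) ^ j * (of_nat (Suc j) * e (Suc j)) = (\<Sum>k\<le>j. (-1) ^ (j - k) * e (j - k) * p (Suc k))"
    by (simp add: E mult_ac)
  also have "\<dots> = (-1) ^ j * (\<Sum>k\<le>j. (-1) ^ k * e (j - k) * p (Suc k))"
    unfolding sum_distrib_left
  proof (rule sum.cong)
    fix k assume "k \<in> {..j}"
    hence "(-1) ^ j = (-1 :: complex) ^ (j - k) * (-1) ^ k" by (simp flip: power_add)
    hence "(-1) ^ (j - k) = (-1 :: complex) ^ j * (-1) ^ k" by (simp flip: power_mult_distrib)
    thus "(-1) ^ (j - k) * e (j - k) * p (Suc k) = (-1) ^ j * ((-1) ^ k * e (j - k) * p (Suc k))" by simp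
  qed auto
  finally show ?thesis by simp
qed

section \<open>Expansions of the coefficients\<close>

lemma fps_conv_radius_sum_ge:
  fixes F :: "'a \<Rightarrow> complex fps"
  assumes "\<And>i. i \<in> A \<Longrightarrow> fps_conv_radius (F i) \<ge> r"
  shows "fps_conv_radius (\<Sum>i\<in>A. F i) \<ge> r"
  using assms
  by (induction A rule: infinite_finite_induct)
     (auto intro!: order_trans[OF _ fps_conv_radius_add])

lemma eval_fps_sum:
  fixes F :: "'a \<Rightarrow> complex fps"
  assumes "\<And>i. i \<in> A \<Longrightarrow> ereal (norm z) < fps_conv_radius (F i)"
  shows "eval_fps (\<Sum>i\<in>A. F i) z = (\<Sum>i\<in>A. eval_fps (F i) z)"
  using assms
proof (induction A rule: infinite_finite_induct)
  case (insert i A)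
  have "ereal (norm z) < fps_conv_radius (\<Sum>i\<in>A. F i)"
  proof (cases "A = {}")
    case False
    define r where "r = Min ((\<lambda>i. fps_conv_radius (F i)) ` A)"
    have "ereal (norm z) < r" using insert False by (auto simp: r_def)
    also have "r \<le> fps_conv_radius (\<Sum>i\<in>A. F i)"
      using insert by (intro fps_conv_radius_sum_ge) (auto simp: r_def)
    finally show ?thesis .
  qed simp
  thus ?case using insert by (simp add: eval_fps_add)
qed simp_all

text \<open>
  The coefficients of the power sums are traces of elements of \<open>\<int>[e^(2ix), e^(-2ix)]\<close>.
\<close>
lemma q4_rational_full_power_sum:
  assumes "n > 0"
  shows "q4_rational (\<lambda>\<tau>. \<Sum>i=1..n. b_coeff n i \<tau> ^ k)"
proof -
  define F where "F = (\<Sum>i=1..n. theta_quotient_fps (theta_node n i) ^ k)"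
  have "fps_nth F N \<in> \<int>" for N
    using laurent_fps_power[OF laurent_fps_theta_quotient, of k]
      laurent_ring_trace[OF _ assms, of "\<lambda>x. fps_nth (theta_quotient_fps x ^ k) N"]
    by (simp add: laurent_fps_def F_def fps_sum_nth)
  then obtain c where c: "\<And>N. fps_nth F N = of_int (c N)"
    unfolding Ints_def by (auto simp: image_iff) metis
  have F: "fps_int_to_complex (Abs_fps c) = F"
    by (simp add: fps_eq_iff c)
  have radius: "fps_conv_radius (theta_quotient_fps (theta_node n i) ^ k) \<ge> 1" for i
    using order_trans[OF eval_theta_quotient_fps(1) fps_conv_radius_power] .
  have "q4_integral (\<lambda>\<tau>. \<Sum>i=1..n. b_coeff n i \<tau> ^ k) (Abs_fps c)"
    unfolding q4_integral_def F
  proof (intro conjI ballI)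
    show "fps_conv_radius F \<ge> 1"
      unfolding F_def by (intro fps_conv_radius_sum_ge radius)
    fix \<tau> assume "\<tau> \<in> upper_half_plane"
    hence \<tau>: "Im \<tau> > 0" by (simp add: upper_half_plane_def)
    have X: "ereal (norm (qpow \<tau> (1/4))) < 1" using norm_qpow_less_1[OF \<tau>, of "1/4"] by simp
    have "eval_fps F (qpow \<tau> (1/4)) =
          (\<Sum>i=1..n. eval_fps (theta_quotient_fps (theta_node n i) ^ k) (qpow \<tau> (1/4)))"
      unfolding F_def by (intro eval_fps_sum less_le_trans[OF X radius])
    also have "\<dots> = (\<Sum>i=1..n. b_coeff n i \<tau> ^ k)"
    proof (rule sum.cong)
      fix i
      have "eval_fps (theta_quotient_fps (theta_node n i) ^ k) (qpow \<tau> (1/4)) =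
            eval_fps (theta_quotient_fps (theta_node n i)) (qpow \<tau> (1/4)) ^ k"
        by (intro eval_fps_power less_le_trans[OF X eval_theta_quotient_fps(1)])
      thus "eval_fps (theta_quotient_fps (theta_node n i) ^ k) (qpow \<tau> (1/4)) = b_coeff n i \<tau> ^ k"
        by (simp add: eval_theta_quotient_fps(2)[OF \<tau>] b_coeff_conv_theta_node)
    qed auto
    finally show "(\<Sum>i=1..n. b_coeff n i \<tau> ^ k) = eval_fps F (qpow \<tau> (1/4))" ..
  qed
  thus ?thesis unfolding q4_rational_def by (intro exI[of _ 1]) auto
qed

lemma b_coeff_reflect:
  assumes "1 \<le> i" "i \<le> n"
  shows "b_coeff n (n + 1 - i) \<tau> = b_coeff n i \<tau>"
proof -
  have "theta_node n (n + 1 - i) = - theta_node n i + pi"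
    using assms by (simp add: theta_node_def field_simps of_nat_diff)
  hence node: "of_real (theta_node n (n + 1 - i)) = - of_real (theta_node n i) + (of_real pi :: complex)"
    by simp
  show ?thesis
    unfolding b_coeff_conv_theta_node node theta2_add_pi theta3_add_pi theta2_minus theta3_minus by simp
qed

lemma theta2_half_pi: "theta2 (of_real (pi / 2)) \<tau> = 0"
proof -
  have "theta2 (- of_real (pi / 2) + of_real pi) \<tau> = - theta2 (of_real (pi / 2)) \<tau>"
    by (simp only: theta2_add_pi theta2_minus)
  moreover have "- of_real (pi / 2) + of_real pi = (of_real (pi / 2) :: complex)" by simp
  ultimately show ?thesis by simp
qed

lemma sum_pairing:
  fixes g :: "nat \<Rightarrow> complex"
  assumes "\<And>k. 1 \<le> k \<Longrightarrow> k \<le> n \<Longrightarrow> g (n + 1 - k) = g k" "odd n \<Longrightarrow> g (n div 2 + 1) = 0"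
  shows "(\<Sum>k=1..n. g k) = 2 * (\<Sum>k=1..n div 2. g k)"
proof -
  define d where "d = n div 2"
  have n: "n = 2 * d + (if odd n then 1 else 0)" unfolding d_def by presburger
  have "(\<Sum>k=1..n. g k) = (\<Sum>k\<in>{1..d} \<union> {n + 1 - d..n}. g k)"
  proof (rule sum.mono_neutral_right)
    show "\<forall>i\<in>{1..n} - ({1..d} \<union> {n + 1 - d..n}). g i = 0"
    proof
      fix i assume i: "i \<in> {1..n} - ({1..d} \<union> {n + 1 - d..n})"
      hence "odd n \<and> i = d + 1" using n by (auto split: if_splits)
      thus "g i = 0" using assms(2) by (simp add: d_def)
    qed
  qed (use n in \<open>auto split: if_splits\<close>)
  also have "\<dots> = (\<Sum>k=1..d. g k) + (\<Sum>k=n + 1 - d..n. g k)"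
    by (rule sum.union_disjoint) (use n in \<open>auto split: if_splits\<close>)
  also have "(\<Sum>k=n + 1 - d..n. g k) = (\<Sum>k=1..d. g k)"
    by (rule sum.reindex_bij_witness[of _ "\<lambda>k. n + 1 - k" "\<lambda>k. n + 1 - k"])
       (use n assms(1) in \<open>auto split: if_splits\<close>)
  finally show ?thesis by (simp add: d_def)
qed

text \<open>
  The sum over all \<open>n\<close> nodes counts each \<open>b_i\<close> with \<open>i \<le> n/2\<close> twice, and for odd \<open>n\<close> the middle node is
  \<open>\<pi>/2\<close>, a zero of \<open>\<theta>\<^sub>2\<close>.
\<close>
lemma q4_rational_power_sum:
  assumes "n > 0" "k > 0"
  shows "q4_rational (\<lambda>\<tau>. \<Sum>i=1..n div 2. b_coeff n i \<tau> ^ k)"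
proof -
  have double: "(\<Sum>i=1..n. b_coeff n i \<tau> ^ k) = of_nat 2 * (\<Sum>i=1..n div 2. b_coeff n i \<tau> ^ k)" for \<tau>
  proof -
    have "b_coeff n (n div 2 + 1) \<tau> ^ k = 0" if "odd n"
    proof -
      from that obtain m where m: "n = 2 * m + 1" by (elim oddE)
      have "theta_node n (n div 2 + 1) = pi / 2"
        by (simp add: theta_node_def m field_simps)
      thus ?thesis
        unfolding b_coeff_conv_theta_node by (simp only: theta2_half_pi) (use assms(2) in simp)
    qed
    thus ?thesis by (subst sum_pairing) (auto simp: b_coeff_reflect[unfolded Suc_eq_plus1[symmetric]] b_coeff_reflect)
  qed
  show ?thesis
    using q4_rational_full_power_sum[OF assms(1), of k] unfolding double
    by (rule q4_rational_of_nat_multD) simp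
qed

lemma q4_rational_S_coeff:
  assumes "n > 0"
  shows "q4_rational (\<lambda>\<tau>. S_coeff n j \<tau>)"
proof (induction j rule: less_induct)
  case (less j)
  show ?case
  proof (cases j)
    case 0
    thus ?thesis using q4_rational_const[of 1] by simp
  next
    case (Suc i)
    have newton: "of_nat (Suc i) * S_coeff n (Suc i) \<tau> =
       (\<Sum>k\<le>i. of_int ((-1) ^ k) * S_coeff n (i - k) \<tau> * (\<Sum>l=1..n div 2. b_coeff n l \<tau> ^ Suc k))" for \<tau>
      unfolding S_coeff_def by (subst newton_identity) simp_all
    have "q4_rational (\<lambda>\<tau>. \<Sum>k\<le>i. of_int ((-1) ^ k) * S_coeff n (i - k) \<tau> *
                     (\<Sum>l=1..n div 2. b_coeff n l \<tau> ^ Suc k))"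
      using Suc by (intro q4_rational_sum q4_rational_mult q4_rational_const less
                      q4_rational_power_sum assms) auto
    thus ?thesis
      unfolding newton [symmetric] Suc by (rule q4_rational_of_nat_multD) simp
  qed
qed

lemma S_coeff_common_denominator:
  assumes "n > 0"
  obtains M :: nat and R where "M > 0" "\<And>j. j \<le> d \<Longrightarrow> q4_integral (\<lambda>\<tau>. of_nat M * S_coeff n j \<tau>) (R j)"
proof -
  have "\<exists>m P. m > 0 \<and> q4_integral (\<lambda>\<tau>. of_nat m * S_coeff n j \<tau>) P" for j
    using q4_rational_S_coeff[OF assms, of j] unfolding q4_rational_def by blast
  then obtain m P where m: "\<And>j. m j > (0::nat)" "\<And>j. q4_integral (\<lambda>\<tau>. of_nat (m j) * S_coeff n j \<tau>) (P j)"
    by metis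
  define M where "M = (\<Prod>j\<le>d. m j)"
  define R where "R = (\<lambda>j. fps_const (int (\<Prod>i\<in>{..d} - {j}. m i)) * P j)"
  show thesis
  proof (rule that[of M R])
    show "M > 0" using m(1) by (simp add: M_def)
    fix j assume j: "j \<le> d"
    have "M = (\<Prod>i\<in>{..d} - {j}. m i) * m j"
      unfolding M_def using j by (subst prod.remove[of _ j]) (auto simp: mult.commute)
    hence "(\<lambda>\<tau>. of_nat M * S_coeff n j \<tau>) =
           (\<lambda>\<tau>. of_int (int (\<Prod>i\<in>{..d} - {j}. m i)) * (of_nat (m j) * S_coeff n j \<tau>))"
      by (simp add: fun_eq_iff del: of_nat_prod)
    thus "q4_integral (\<lambda>\<tau>. of_nat M * S_coeff n j \<tau>) (R j)"
      unfolding R_def by (simp only:) (intro q4_integral_mult q4_integral_const m)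
  qed
qed

lemma coeff_sum_monom_atMost: "coeff (\<Sum>k\<le>n. monom (a k) k) j = (if j \<le> n then a j else 0)"
  by (simp add: coeff_sum)

lemma poly_map_poly_sum_monom:
  fixes f :: "'a :: comm_monoid_add \<Rightarrow> 'b :: comm_ring_1"
  assumes "f 0 = 0"
  shows "poly (map_poly f (\<Sum>k\<le>n. monom (a k) k)) z = (\<Sum>k\<le>n. f (a k) * z ^ k)"
proof -
  have "map_poly f (\<Sum>k\<le>n. monom (a k) k) = (\<Sum>k\<le>n. monom (f (a k)) k)"
    by (rule poly_eqI) (simp add: coeff_map_poly[of f] assms coeff_sum_monom_atMost)
  thus ?thesis by (simp add: poly_sum poly_monom)
qed

lemma sum_even_indices:
  fixes g :: "nat \<Rightarrow> 'a :: comm_monoid_add"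
  shows "(\<Sum>k\<le>n. if even k then g k else 0) = (\<Sum>j\<le>n div 2. g (2 * j))"
proof -
  have "(\<Sum>k\<le>n. if even k then g k else 0) = (\<Sum>k | k \<le> n \<and> even k. g k)"
    by (intro sum.mono_neutral_cong_right) auto
  also have "\<dots> = (\<Sum>j\<le>n div 2. g (2 * j))"
    by (rule sum.reindex_bij_witness[of _ "\<lambda>j. 2 * j" "\<lambda>k. k div 2"]) auto
  finally show ?thesis .
qed

text \<open>
  Multiplying numerator and denominator by a common denominator \<open>M\<close> of the \<open>S_j\<close> makes all
  coefficients integral power series. The numerator is the reversed denominator, so both are built
  from one coefficient function \<open>\<beta>\<close>.
\<close>
lemma chebyshev_blaschke_integral_quotient:
  assumes n: "n > 0"
  shows "\<exists>A B :: int fps poly. \<forall>\<tau>\<in>pos_imag_axis.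
        coeffs_converge_q4 A \<tau> \<and> coeffs_converge_q4 B \<tau> \<and>
        (\<forall>z. norm z < 1 \<longrightarrow>
           poly (eval_coeffs_q4 B \<tau>) z \<noteq> 0 \<and>
           chebyshev_blaschke n \<tau> z = poly (eval_coeffs_q4 A \<tau>) z / poly (eval_coeffs_q4 B \<tau>) z)"
proof -
  define d where "d = n div 2"
  obtain M :: nat and R where M: "M > 0" and
     R: "\<And>j. j \<le> d \<Longrightarrow> q4_integral (\<lambda>\<tau>. of_nat M * S_coeff n j \<tau>) (R j)"
    using S_coeff_common_denominator[OF n] by metis
  define \<beta> where "\<beta> = (\<lambda>k. if even k then fps_const ((-1) ^ (k div 2)) * R (k div 2) else 0)"
  define B where "B = (\<Sum>k\<le>n. monom (\<beta> k) k)"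
  define A where "A = (\<Sum>k\<le>n. monom (\<beta> (n - k)) k)"
  define g where "g = (\<lambda>k \<tau>. if even k then (-1) ^ (k div 2) * (of_nat M * S_coeff n (k div 2) \<tau>) else 0)"
  have \<beta>: "q4_integral (g k) (\<beta> k)" if "k \<le> n" for k
  proof (cases "even k")
    case True
    have "q4_integral (\<lambda>\<tau>. of_int ((-1) ^ (k div 2)) * (of_nat M * S_coeff n (k div 2) \<tau>)) (\<beta> k)"
      unfolding \<beta>_def if_P[OF True] using that
      by (intro q4_integral_mult q4_integral_const R) (auto simp: d_def intro: div_le_mono)
    thus ?thesis using True by (simp add: g_def)
  next
    case False
    thus ?thesis using q4_integral_const[of 0] by (simp add: g_def \<beta>_def)
  qed
  have coeffs: "coeff B k = (if k \<le> n then \<beta> k else 0)" "coeff A k = (if k \<le> n then \<beta> (n - k) else 0)" for k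
    by (simp_all add: A_def B_def coeff_sum_monom_atMost)
  have main: "coeffs_converge_q4 A \<tau> \<and> coeffs_converge_q4 B \<tau> \<and>
        (\<forall>z. norm z < 1 \<longrightarrow>
           poly (eval_coeffs_q4 B \<tau>) z \<noteq> 0 \<and>
           chebyshev_blaschke n \<tau> z = poly (eval_coeffs_q4 A \<tau>) z / poly (eval_coeffs_q4 B \<tau>) z)"
    if \<tau>: "\<tau> \<in> pos_imag_axis" for \<tau>
  proof (intro conjI allI impI)
    have \<tau>': "\<tau> \<in> upper_half_plane" using \<tau> by (auto simp: pos_imag_axis_def upper_half_plane_def)
    have conv0: "ereal (norm (qpow \<tau> (1/4))) < fps_conv_radius (fps_int_to_complex 0)"
      using norm_q4_less_radius[OF q4_integral_const[of 0] \<tau>'] by simp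
    show "coeffs_converge_q4 A \<tau>" "coeffs_converge_q4 B \<tau>"
      unfolding coeffs_converge_q4_def coeffs
      using norm_q4_less_radius[OF \<beta> \<tau>'] conv0 by auto
    have ev: "eval_fps (fps_int_to_complex (\<beta> k)) (qpow \<tau> (1/4)) = g k \<tau>" if "k \<le> n" for k
      using \<beta>[OF that] \<tau>' by (simp add: q4_integral_def)
    have ev0: "eval_fps (fps_int_to_complex 0) (qpow \<tau> (1/4)) = 0"
      using q4_integral_const[of 0] \<tau>' by (simp add: q4_integral_def)
    fix z :: complex assume z: "norm z < 1"
    define D where "D = 1 + (\<Sum>j=1..d. (-1)^j * S_coeff n j \<tau> * z^(2*j))"
    define N where "N = z^(2*d) + (\<Sum>j=1..d. (-1)^j * S_coeff n j \<tau> * z^(2*d - 2*j))"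
    have D: "D \<noteq> 0" and cb: "chebyshev_blaschke n \<tau> z = z ^ (n mod 2) * (N / D)"
      using chebyshev_blaschke_expansion[OF n \<tau> z] by (simp_all add: D_def N_def d_def)
    have split: "(\<Sum>j\<le>d. h j) = h 0 + (\<Sum>j=1..d. h j)" for h :: "nat \<Rightarrow> complex"
      by (simp add: atMost_atLeast0 sum.atLeast_Suc_atMost)
    have polyB: "poly (eval_coeffs_q4 B \<tau>) z = of_nat M * D"
    proof -
      have "poly (eval_coeffs_q4 B \<tau>) z = (\<Sum>k\<le>n. g k \<tau> * z ^ k)"
        unfolding eval_coeffs_q4_def B_def
        by (subst poly_map_poly_sum_monom) (auto simp: ev ev0)
      also have "\<dots> = (\<Sum>k\<le>n. if even k then g k \<tau> * z ^ k else 0)"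
        by (intro sum.cong) (auto simp: g_def)
      also have "\<dots> = (\<Sum>j\<le>d. of_nat M * ((-1) ^ j * S_coeff n j \<tau> * z ^ (2 * j)))"
        unfolding sum_even_indices d_def by (intro sum.cong) (auto simp: g_def)
      also have "\<dots> = of_nat M * D"
        unfolding D_def sum_distrib_left [symmetric] split by simp
      finally show ?thesis .
    qed
    have polyA: "poly (eval_coeffs_q4 A \<tau>) z = of_nat M * (z ^ (n mod 2) * N)"
    proof -
      have "poly (eval_coeffs_q4 A \<tau>) z = (\<Sum>k\<le>n. g (n - k) \<tau> * z ^ k)"
        unfolding eval_coeffs_q4_def A_def
        by (subst poly_map_poly_sum_monom) (auto simp: ev ev0)
      also have "\<dots> = (\<Sum>k\<le>n. g k \<tau> * z ^ (n - k))"
        by (rule sum.reindex_bij_witness[of _ "\<lambda>k. n - k" "\<lambda>k. n - k"]) auto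
      also have "\<dots> = (\<Sum>k\<le>n. if even k then g k \<tau> * z ^ (n - k) else 0)"
        by (intro sum.cong) (auto simp: g_def)
      also have "\<dots> = (\<Sum>j\<le>d. of_nat M * (z ^ (n mod 2) * ((-1) ^ j * S_coeff n j \<tau> * z ^ (2 * d - 2 * j))))"
        unfolding sum_even_indices d_def[symmetric]
      proof (rule sum.cong)
        fix j assume "j \<in> {..d}"
        hence "n - 2 * j = n mod 2 + (2 * d - 2 * j)"
          unfolding d_def atMost_iff using mult_div_mod_eq[of 2 n] by linarith
        hence "z ^ (n - 2 * j) = z ^ (n mod 2) * z ^ (2 * d - 2 * j)" by (simp add: power_add)
        thus "g (2 * j) \<tau> * z ^ (n - 2 * j) =
              of_nat M * (z ^ (n mod 2) * ((-1) ^ j * S_coeff n j \<tau> * z ^ (2 * d - 2 * j)))"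
          by (simp add: g_def)
      qed auto
      also have "\<dots> = of_nat M * (z ^ (n mod 2) * N)"
        unfolding N_def sum_distrib_left [symmetric] split by simp
      finally show ?thesis .
    qed
    show "poly (eval_coeffs_q4 B \<tau>) z \<noteq> 0" using polyB D M by simp
    show "chebyshev_blaschke n \<tau> z = poly (eval_coeffs_q4 A \<tau>) z / poly (eval_coeffs_q4 B \<tau>) z"
      unfolding polyA polyB cb using M by simp
  qed
  show ?thesis using main by blast
qed

theorem theorem9p7:
  fixes n :: nat
  assumes "n \<ge> 1"
  shows
    "(\<forall>\<tau>\<in>pos_imag_axis. \<forall>z. norm z < 1 \<longrightarrow>
        1 + (\<Sum>j=1..n div 2. (-1)^j * S_coeff n j \<tau> * z^(2*j)) \<noteq> 0 \<and>
        chebyshev_blaschke n \<tau> z =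
          z^(n mod 2) *
          ((z^(2*(n div 2)) + (\<Sum>j=1..n div 2. (-1)^j * S_coeff n j \<tau> * z^(2*(n div 2) - 2*j))) /
           (1 + (\<Sum>j=1..n div 2. (-1)^j * S_coeff n j \<tau> * z^(2*j))))) \<and>
     (\<forall>j\<in>{1..n div 2}.
        (\<exists>F\<in>Frac_int_fps. has_q4_expansion (\<lambda>\<tau>. S_coeff n j \<tau>) F) \<and>
        (\<exists>F\<in>Frac_int_fps. has_q4_expansion (\<lambda>\<tau>. - S_coeff n j \<tau>) F)) \<and>
     (\<exists>A B :: int fps poly. \<forall>\<tau>\<in>pos_imag_axis.
        coeffs_converge_q4 A \<tau> \<and> coeffs_converge_q4 B \<tau> \<and>
        (\<forall>z. norm z < 1 \<longrightarrow>
           poly (eval_coeffs_q4 B \<tau>) z \<noteq> 0 \<and>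
           chebyshev_blaschke n \<tau> z = poly (eval_coeffs_q4 A \<tau>) z / poly (eval_coeffs_q4 B \<tau>) z))"
proof -
  have n: "n > 0" using assms by simp
  have S: "q4_rational (\<lambda>\<tau>. S_coeff n j \<tau>)" "q4_rational (\<lambda>\<tau>. - S_coeff n j \<tau>)" for j
    using q4_rational_S_coeff[OF n, of j]
      q4_rational_mult[OF q4_rational_const[of "-1"] q4_rational_S_coeff[OF n, of j]] by simp_all
  show ?thesis
    by (intro conjI ballI allI impI chebyshev_blaschke_expansion[OF n]
          q4_rational_has_expansion[OF S(1)] q4_rational_has_expansion[OF S(2)]
          chebyshev_blaschke_integral_quotient[OF n])
qed

end
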